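(* Let $\mathcal{C}$ be a collection of subgroups of a discrete group $G$. Suppose that $F$ is a $G$-equivariant poset endomorphism of $\mathcal{C}$ satisfying either $F\ge \mathrm{Id}_{\mathcal{C}}$ (that is, $F(P)\ge P$ for all $P\in\mathcal{C}$) or $F\le\mathrm{Id}_{\mathcal{C}}$ (that is, $F(P)\le P$ for all $P\in\mathcal{C}$). Set $\mathcal{C}'=F(\mathcal{C})$. (1) Assume that the case $F\ge\mathrm{Id}_{\mathcal{C}}$ of the hypothesis holds. Then the inclusion $E\mathbf{O}_{\mathcal{C}'}\to E\mathbf{O}_{\mathcal{C}}$ induces a $G$-homotopy equivalence on nerves. (2) Assume for all $P\in\mathcal{C}$ that $C_G(P)\le C_G(F(P))$. Then the inclusion $E\mathbf{A}_{\mathcal{C}'}\to E\mathbf{A}_{\mathcal{C}}$ induces a $G$-homotopy equivalence on nerves. (This further hypothesis holds in the case $F\le\mathrm{Id}_{\mathcal{C}}$.) (3) The inclusion $\mathcal{C}'\to\mathcal{C}$ induces a $G$-homotopy equivalence on nerves.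
   Context: A collection $\mathcal{C}$ of subgroups of $G$ is a set of subgroups closed under $G$-conjugation; it is a poset under inclusion with $G$ acting by conjugation. $E\mathbf{O}_{\mathcal{C}}$ is the category with objects the pairs $(G/H,x)$, where $H\in\mathcal{C}$ and $x\in G/H$; morphisms $(G/H,x)\to(G/H',x')$ are the $G$-maps $G/H\to G/H'$ sending $x$ to $x'$. $G$ acts by $g\cdot(G/H,x)=(G/H,gx)$. $E\mathbf{A}_{\mathcal{C}}$ is the category with objects the monomorphisms $i:H\to G$ with $H\in\mathcal{C}$ and $i(H)\in\mathcal{C}$; morphisms from $i:H\to G$ to $i':H'\to G$ are the homomorphisms $\varphi:H\to H'$ with $i=i'\circ\varphi$. $G$ acts by postcomposing $i$ with conjugation. A $G$-homotopy equivalence is a $G$-equivariant homotopy equivalence; for nerves of categories with $G$-action, a $G$-map is a $G$-homotopy equivalence if and only if it induces an ordinary homotopy equivalence on $H$-fixed points for all subgroups $H\le G$. *)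

theory Defs
  imports "HOL-Algebra.Left_Coset" "HOL-Analysis.Analysis" "HOL-Homology.Simplices"
begin

section \<open>Small categories and functors\<close>

text \<open>
  \<^term>\<open>Comp\<close> takes the three objects and then the arrows in the order of functional composition:
  if f is in Hom x y and g is in Hom y z, then Comp x y z g f is in Hom x z.
  Hom-sets for different pairs of objects are not required to be disjoint.
\<close>

record ('o, 'f) small_cat =
  Ob :: "'o set"
  Hom :: "'o \<Rightarrow> 'o \<Rightarrow> 'f set"
  Ident :: "'o \<Rightarrow> 'f"
  Comp :: "'o \<Rightarrow> 'o \<Rightarrow> 'o \<Rightarrow> 'f \<Rightarrow> 'f \<Rightarrow> 'f"

record ('o, 'f, 'p, 'h) cat_functor =
  on_ob :: "'o \<Rightarrow> 'p"
  on_arr :: "'o \<Rightarrow> 'o \<Rightarrow> 'f \<Rightarrow> 'h"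

definition inclusion_functor :: "('o, 'f, 'o, 'f) cat_functor" where
  "inclusion_functor = \<lparr> on_ob = (\<lambda>x. x), on_arr = (\<lambda>_ _ \<phi>. \<phi>) \<rparr>"


section \<open>The nerve and its geometric realization\<close>

text \<open>
  An n-simplex of the nerve is a functor from the ordinal 0 < 1 < ... < n to the category, given
  by its objects x i and its arrows f (i, j) from x i to x j for i \<open>\<le>\<close> j; both families are
  extensional, so that equal functors are equal terms.
\<close>

definition ordinal_arrows :: "nat \<Rightarrow> (nat \<times> nat) set" where
  "ordinal_arrows n = {(i, j). i \<le> j \<and> j \<le> n}"

type_synonym ('o, 'f) nerve_simplex = "(nat \<Rightarrow> 'o) \<times> (nat \<times> nat \<Rightarrow> 'f)"

definition nerve :: "('o, 'f) small_cat \<Rightarrow> nat \<Rightarrow> ('o, 'f) nerve_simplex set" where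
  "nerve K n = {(x, f).
      x \<in> {..n} \<rightarrow>\<^sub>E Ob K \<and>
      f \<in> (\<Pi>\<^sub>E (i, j) \<in> ordinal_arrows n. Hom K (x i) (x j)) \<and>
      (\<forall>i \<le> n. f (i, i) = Ident K (x i)) \<and>
      (\<forall>i j k. i \<le> j \<and> j \<le> k \<and> k \<le> n \<longrightarrow>
         f (i, k) = Comp K (x i) (x j) (x k) (f (j, k)) (f (i, j)))}"

text \<open>
  A monotone \<open>\<theta>\<close> from {0..m} to {0..n} acts on simplices of the nerve contravariantly by
  precomposition, and on standard simplices covariantly as the affine map sending the i-th vertex
  to the \<open>\<theta>\<close> i-th one.
\<close>

definition nerve_pull :: "nat \<Rightarrow> (nat \<Rightarrow> nat) \<Rightarrow> ('o, 'f) nerve_simplex \<Rightarrow> ('o, 'f) nerve_simplex" where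
  "nerve_pull m \<theta> = (\<lambda>(x, f).
     (\<lambda>i\<in>{..m}. x (\<theta> i), \<lambda>(i, j)\<in>ordinal_arrows m. f (\<theta> i, \<theta> j)))"

definition simplex_push :: "nat \<Rightarrow> (nat \<Rightarrow> nat) \<Rightarrow> (nat \<Rightarrow> real) \<Rightarrow> (nat \<Rightarrow> real)" where
  "simplex_push m \<theta> t = (\<lambda>j. \<Sum>i | i \<le> m \<and> \<theta> i = j. t i)"

definition nerve_map ::
    "('o, 'f, 'p, 'h) cat_functor \<Rightarrow> nat \<Rightarrow> ('o, 'f) nerve_simplex \<Rightarrow> ('p, 'h) nerve_simplex" where
  "nerve_map \<Phi> n = (\<lambda>(x, f).
     (\<lambda>i\<in>{..n}. on_ob \<Phi> (x i), \<lambda>(i, j)\<in>ordinal_arrows n. on_arr \<Phi> (x i) (x j) (f (i, j))))"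

definition quotient_topology :: "'a topology \<Rightarrow> ('a \<Rightarrow> 'b) \<Rightarrow> 'b topology" where
  "quotient_topology X q =
     topology (\<lambda>U. U \<subseteq> q ` topspace X \<and> openin X {x \<in> topspace X. q x \<in> U})"

lemma istopology_quotient_topology:
  "istopology (\<lambda>U. U \<subseteq> q ` topspace X \<and> openin X {x \<in> topspace X. q x \<in> U})"
proof -
  have 1: "{x \<in> topspace X. q x \<in> S \<inter> T} =
      {x \<in> topspace X. q x \<in> S} \<inter> {x \<in> topspace X. q x \<in> T}" for S T
    by blast
  have 2: "{x \<in> topspace X. q x \<in> \<Union>\<U>} = (\<Union>S\<in>\<U>. {x \<in> topspace X. q x \<in> S})" for \<U>
    by blast
  show ?thesis
    unfolding istopology_def 1 2 by blast
qed

lemma openin_quotient_topology: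
  "openin (quotient_topology X q) U \<longleftrightarrow>
     U \<subseteq> q ` topspace X \<and> openin X {x \<in> topspace X. q x \<in> U}"
  unfolding quotient_topology_def topology_inverse'[OF istopology_quotient_topology] ..

lemma topspace_quotient_topology [simp]:
  "topspace (quotient_topology X q) = q ` topspace X"
proof (rule subset_antisym)
  show "topspace (quotient_topology X q) \<subseteq> q ` topspace X"
    using openin_topspace[of "quotient_topology X q"]
    unfolding openin_quotient_topology by (rule conjunct1)
  have "{x \<in> topspace X. q x \<in> q ` topspace X} = topspace X"
    by blast
  then have "openin (quotient_topology X q) (q ` topspace X)"
    unfolding openin_quotient_topology by (metis openin_topspace subset_refl)
  then show "q ` topspace X \<subseteq> topspace (quotient_topology X q)"
    by (rule openin_subset)
qed

lemma quotient_map_quotient_topology: "quotient_map X (quotient_topology X q) q"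
  unfolding quotient_map_def topspace_quotient_topology openin_quotient_topology by blast

text \<open>
  The geometric realization is the quotient of the disjoint union over n of the products of the
  (discrete) set of n-simplices with the standard n-simplex, by the equivalence relation generated
  by (\<open>\<theta>\<close>-pullback of \<open>\<sigma>\<close>, t) \<open>\<sim>\<close> (\<open>\<sigma>\<close>, \<open>\<theta>\<close>-pushforward of t). Its points are equivalence classes.
\<close>

type_synonym ('o, 'f) cell_point = "nat \<times> ('o, 'f) nerve_simplex \<times> (nat \<Rightarrow> real)"

definition cell_space :: "('o, 'f) small_cat \<Rightarrow> ('o, 'f) cell_point topology" where
  "cell_space K = sum_topology
     (\<lambda>n. prod_topology (discrete_topology (nerve K n))
            (subtopology (powertop_real UNIV) (standard_simplex n))) UNIV"

definition glue :: "('o, 'f) small_cat \<Rightarrow> ('o, 'f) cell_point \<Rightarrow> ('o, 'f) cell_point \<Rightarrow> bool" where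
  "glue K p q \<longleftrightarrow> (\<exists>m n \<theta> \<sigma> t.
     \<sigma> \<in> nerve K n \<and> t \<in> standard_simplex m \<and>
     mono_on {..m} \<theta> \<and> \<theta> ` {..m} \<subseteq> {..n} \<and>
     p = (m, nerve_pull m \<theta> \<sigma>, t) \<and> q = (n, \<sigma>, simplex_push m \<theta> t))"

definition realization_class ::
    "('o, 'f) small_cat \<Rightarrow> ('o, 'f) cell_point \<Rightarrow> ('o, 'f) cell_point set" where
  "realization_class K p = {q. equivclp (glue K) p q}"

definition realization :: "('o, 'f) small_cat \<Rightarrow> ('o, 'f) cell_point set topology" where
  "realization K = quotient_topology (cell_space K) (realization_class K)"

text \<open>
  The map of realizations induced by a functor with target L. The union runs over all
  representatives of a class; for a functor all of them give the same class.
\<close>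

definition realization_map ::
    "('p, 'h) small_cat \<Rightarrow> ('o, 'f, 'p, 'h) cat_functor \<Rightarrow>
     ('o, 'f) cell_point set \<Rightarrow> ('p, 'h) cell_point set" where
  "realization_map L \<Phi> S = (\<Union>(n, \<sigma>, t)\<in>S. realization_class L (n, nerve_map \<Phi> n \<sigma>, t))"


section \<open>Equivariant homotopy equivalences\<close>

definition G_equivariant ::
    "('g, 'c) monoid_scheme \<Rightarrow> 'x topology \<Rightarrow> ('g \<Rightarrow> 'x \<Rightarrow> 'x) \<Rightarrow> ('g \<Rightarrow> 'y \<Rightarrow> 'y) \<Rightarrow>
     ('x \<Rightarrow> 'y) \<Rightarrow> bool" where
  "G_equivariant G X a b f \<longleftrightarrow>
     (\<forall>g\<in>carrier G. \<forall>x\<in>topspace X. f (a g x) = b g (f x))"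

definition G_map ::
    "('g, 'c) monoid_scheme \<Rightarrow> 'x topology \<Rightarrow> ('g \<Rightarrow> 'x \<Rightarrow> 'x) \<Rightarrow>
     'y topology \<Rightarrow> ('g \<Rightarrow> 'y \<Rightarrow> 'y) \<Rightarrow> ('x \<Rightarrow> 'y) \<Rightarrow> bool" where
  "G_map G X a Y b f \<longleftrightarrow> continuous_map X Y f \<and> G_equivariant G X a b f"

text \<open>
  A homotopy all of whose stages are equivariant is the same as an equivariant map on the
  product with the unit interval, on which G acts trivially.
\<close>

definition G_homotopic ::
    "('g, 'c) monoid_scheme \<Rightarrow> 'x topology \<Rightarrow> ('g \<Rightarrow> 'x \<Rightarrow> 'x) \<Rightarrow>
     'y topology \<Rightarrow> ('g \<Rightarrow> 'y \<Rightarrow> 'y) \<Rightarrow> ('x \<Rightarrow> 'y) \<Rightarrow> ('x \<Rightarrow> 'y) \<Rightarrow> bool" where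
  "G_homotopic G X a Y b = homotopic_with (G_equivariant G X a b) X Y"

definition G_homotopy_equivalence ::
    "('g, 'c) monoid_scheme \<Rightarrow> 'x topology \<Rightarrow> ('g \<Rightarrow> 'x \<Rightarrow> 'x) \<Rightarrow>
     'y topology \<Rightarrow> ('g \<Rightarrow> 'y \<Rightarrow> 'y) \<Rightarrow> ('x \<Rightarrow> 'y) \<Rightarrow> bool" where
  "G_homotopy_equivalence G X a Y b f \<longleftrightarrow>
     G_map G X a Y b f \<and>
     (\<exists>h. G_map G Y b X a h \<and>
          G_homotopic G X a X a (h \<circ> f) id \<and>
          G_homotopic G Y b Y b (f \<circ> h) id)"

text \<open>
  Here K and L are categories on which G acts by the functors \<^term>\<open>a g\<close> and \<^term>\<open>b g\<close>.
\<close>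

definition induces_G_homotopy_equivalence ::
    "('g, 'c) monoid_scheme \<Rightarrow>
     ('o, 'f) small_cat \<Rightarrow> ('g \<Rightarrow> ('o, 'f, 'o, 'f) cat_functor) \<Rightarrow>
     ('p, 'h) small_cat \<Rightarrow> ('g \<Rightarrow> ('p, 'h, 'p, 'h) cat_functor) \<Rightarrow>
     ('o, 'f, 'p, 'h) cat_functor \<Rightarrow> bool" where
  "induces_G_homotopy_equivalence G K a L b \<Phi> \<longleftrightarrow>
     G_homotopy_equivalence G
       (realization K) (\<lambda>g. realization_map K (a g))
       (realization L) (\<lambda>g. realization_map L (b g))
       (realization_map L \<Phi>)"


section \<open>Collections of subgroups and their categories\<close>

definition conjugate :: "('g, 'c) monoid_scheme \<Rightarrow> 'g \<Rightarrow> 'g set \<Rightarrow> 'g set" where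
  "conjugate G g P = g <#\<^bsub>G\<^esub> P #>\<^bsub>G\<^esub> (inv\<^bsub>G\<^esub> g)"

definition collection :: "('g, 'c) monoid_scheme \<Rightarrow> 'g set set \<Rightarrow> bool" where
  "collection G C \<longleftrightarrow>
     (\<forall>P\<in>C. subgroup P G) \<and> (\<forall>g\<in>carrier G. \<forall>P\<in>C. conjugate G g P \<in> C)"

definition centralizer :: "('g, 'c) monoid_scheme \<Rightarrow> 'g set \<Rightarrow> 'g set" where
  "centralizer G P = {g \<in> carrier G. \<forall>p\<in>P. g \<otimes>\<^bsub>G\<^esub> p = p \<otimes>\<^bsub>G\<^esub> g}"

definition poset_cat :: "'g set set \<Rightarrow> ('g set, unit) small_cat" where
  "poset_cat C = \<lparr>
     Ob = C,
     Hom = (\<lambda>P Q. {u. P \<subseteq> Q}),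
     Ident = (\<lambda>_. ()),
     Comp = (\<lambda>_ _ _ _ _. ()) \<rparr>"

definition poset_action ::
    "('g, 'c) monoid_scheme \<Rightarrow> 'g \<Rightarrow> ('g set, unit, 'g set, unit) cat_functor" where
  "poset_action G g = \<lparr> on_ob = conjugate G g, on_arr = (\<lambda>_ _ u. u) \<rparr>"

text \<open>In the following category, an object (X, x) consists of the G-set X = G/H of left cosets and a point x of X.\<close>

type_synonym 'g EO_ob = "'g set set \<times> 'g set"

definition EO ::
    "('g, 'c) monoid_scheme \<Rightarrow> 'g set set \<Rightarrow> ('g EO_ob, 'g set \<Rightarrow> 'g set) small_cat" where
  "EO G C = \<lparr>
     Ob = {(lcosets\<^bsub>G\<^esub> H, x) | H x. H \<in> C \<and> x \<in> lcosets\<^bsub>G\<^esub> H},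
     Hom = (\<lambda>(X, x) (Y, y). {f \<in> X \<rightarrow>\<^sub>E Y.
        (\<forall>g\<in>carrier G. \<forall>z\<in>X. f (g <#\<^bsub>G\<^esub> z) = g <#\<^bsub>G\<^esub> f z) \<and> f x = y}),
     Ident = (\<lambda>(X, x). \<lambda>z\<in>X. z),
     Comp = (\<lambda>(X, x) _ _ f' f. compose X f' f) \<rparr>"

definition EO_action ::
    "('g, 'c) monoid_scheme \<Rightarrow> 'g \<Rightarrow>
     ('g EO_ob, 'g set \<Rightarrow> 'g set, 'g EO_ob, 'g set \<Rightarrow> 'g set) cat_functor" where
  "EO_action G g = \<lparr>
     on_ob = (\<lambda>(X, x). (X, g <#\<^bsub>G\<^esub> x)),
     on_arr = (\<lambda>_ _ f. f) \<rparr>"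

text \<open>In the following category, an object (H, i) is a monomorphism i from H to G.\<close>

type_synonym 'g EA_ob = "'g set \<times> ('g \<Rightarrow> 'g)"

definition EA ::
    "('g, 'c) monoid_scheme \<Rightarrow> 'g set set \<Rightarrow> ('g EA_ob, 'g \<Rightarrow> 'g) small_cat" where
  "EA G C = \<lparr>
     Ob = {(H, i). H \<in> C \<and> i \<in> mon (G\<lparr>carrier := H\<rparr>) G \<and> i \<in> extensional H \<and> i ` H \<in> C},
     Hom = (\<lambda>(H, i) (H', i').
        {\<phi> \<in> hom (G\<lparr>carrier := H\<rparr>) (G\<lparr>carrier := H'\<rparr>).
           \<phi> \<in> extensional H \<and> i = compose H i' \<phi>}),
     Ident = (\<lambda>(H, i). \<lambda>h\<in>H. h),
     Comp = (\<lambda>(H, i) _ _ \<phi>' \<phi>. compose H \<phi>' \<phi>) \<rparr>"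

definition EA_action ::
    "('g, 'c) monoid_scheme \<Rightarrow> 'g \<Rightarrow> ('g EA_ob, 'g \<Rightarrow> 'g, 'g EA_ob, 'g \<Rightarrow> 'g) cat_functor" where
  "EA_action G g = \<lparr>
     on_ob = (\<lambda>(H, i). (H, \<lambda>h\<in>H. g \<otimes>\<^bsub>G\<^esub> i h \<otimes>\<^bsub>G\<^esub> inv\<^bsub>G\<^esub> g)),
     on_arr = (\<lambda>_ _ \<phi>. \<phi>) \<rparr>"

end

theory Submission
  imports Defs
begin

text \<open>
  All three categories are thin: there is at most one arrow between two objects. A point of the
  realization of a thin category is the same as a monotone right-continuous step function
  from [0, 1) to its objects: the barycentric coordinates are the lengths of the intervals and the
  vertices are the values. Two functors \<open>\<phi>\<close> and \<open>\<psi>\<close> with an arrow from \<open>\<phi> x\<close> to \<open>\<psi> x\<close> for all x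
  are connected by the homotopy that sends the step function w at time a to \<open>\<phi> \<circ> w\<close> on [0, a)
  and \<open>\<psi> \<circ> w\<close> on [a, 1), which is monotone again; it is equivariant if the functors are. Hence the
  inclusion is a G-homotopy equivalence as soon as there is an equivariant monotone map of objects
  in the opposite direction whose composites with it are comparable to the identities. For the
  poset this is F itself, for EO it sends (G/H, x) to (G/F(H), x F(H)), and for EA it is extended
  equivariantly from representatives of the G-orbits.
\<close>


section \<open>Points of the simplex as step functions\<close>

text \<open>A G-homotopy equivalence needs an equivariant inverse and equivariant homotopies, so
  these are written down by formulas. Step functions suit this: a functor acts by composing with
  values, which commutes with cutting [0, 1) at a, so every stage of the homotopy is equivariant.
  What step functions hide is the topology. Continuity is therefore checked on cells, where the cut
  is the usual triangulation of a prism, and it passes to the realization because the product of a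
  quotient map with the compact interval is again a quotient map.

  In all three categories the existence of an arrow reduces to an inclusion of subgroups: of the
  isotropy groups aHa^-1 of the points aH in EO, of the images i(H) in EA. Objects with the same
  subgroup are thus isomorphic without being equal, and the map back to the smaller category has to
  be equivariant on the nose, not just up to isomorphism. In EO, the inclusion of P in F(P) makes x
  F(H) depend only on the coset x; in EA, the centralizer hypothesis says that whatever fixes an
  object also fixes the object chosen for it.\<close>

definition step_fun :: "('o, 'f) cell_point \<Rightarrow> real \<Rightarrow> 'o" where
  "step_fun = (\<lambda>(n, (x, f), t). \<lambda>r\<in>{0..<1}. x (LEAST i. r < sum t {..i}))"

text \<open>Partial sums of a nonnegative sequence increase, so the half-open intervals between
  consecutive ones are disjoint. An interval of length zero contains no r; this is how vertices with
  coordinate 0 disappear.\<close>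

lemma step_index_eq:
  fixes t :: "nat \<Rightarrow> real"
  assumes "\<And>i. 0 \<le> t i" "sum t {..<j} \<le> r" "r < sum t {..j}"
  shows "(LEAST i. r < sum t {..i}) = j"
proof (rule Least_equality)
  fix i assume i: "r < sum t {..i}"
  show "j \<le> i"
  proof (rule ccontr)
    assume "\<not> j \<le> i"
    then have "sum t {..i} \<le> sum t {..<j}"
      by (intro sum_mono2) (auto simp: assms)
    with i assms show False by linarith
  qed
qed (use assms in auto)

text \<open>The bound r < 1 = \<open>sum t {..n}\<close> guarantees that an index exists. At r = 1
  there would be none, which is why step functions live on [0, 1).\<close>

lemma step_index:
  assumes t: "t \<in> standard_simplex n" and r: "0 \<le> r" "r < 1"
  defines "j \<equiv> (LEAST i. r < sum t {..i})"
  shows "j \<le> n" "sum t {..<j} \<le> r" "r < sum t {..j}"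
proof -
  have n: "r < sum t {..n}"
    using t r by (simp add: standard_simplex_def)
  show "j \<le> n"
    unfolding j_def by (rule Least_le) (rule n)
  show "r < sum t {..j}"
    unfolding j_def by (rule LeastI) (rule n)
  show "sum t {..<j} \<le> r"
  proof (cases j)
    case (Suc k)
    then have "\<not> r < sum t {..k}"
      unfolding j_def by (metis lessI not_less_Least)
    then show ?thesis by (simp add: Suc lessThan_Suc_atMost)
  qed (use r in auto)
qed

lemma step_fun_eq:
  assumes t: "t \<in> standard_simplex n" and "0 \<le> r" "r < 1"
    and "sum t {..<j} \<le> r" "r < sum t {..j}"
  shows "step_fun (n, \<sigma>, t) r = fst \<sigma> j"
proof -
  have "\<And>i. 0 \<le> t i"
    using t by (simp add: standard_simplex_def)
  from step_index_eq[OF this] assms show ?thesis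
    by (cases \<sigma>) (simp add: step_fun_def)
qed

lemma step_fun_undefined: "r \<notin> {0..<1} \<Longrightarrow> step_fun p r = undefined"
  by (cases p) (auto simp: step_fun_def split: prod.splits)

lemma step_fun_eqI:
  assumes "\<And>r. 0 \<le> r \<Longrightarrow> r < 1 \<Longrightarrow> step_fun p r = step_fun q r"
  shows "step_fun p = step_fun q"
proof
  fix r show "step_fun p r = step_fun q r"
    by (cases "r \<in> {0..<1}") (use assms in \<open>auto simp: step_fun_undefined\<close>)
qed

lemma mem_cell_space:
  "(n, \<sigma>, t) \<in> topspace (cell_space K) \<longleftrightarrow> \<sigma> \<in> nerve K n \<and> t \<in> standard_simplex n"
  by (auto simp: cell_space_def)

lemma nerve_D:
  assumes "(x, f) \<in> nerve K n"
  shows "\<And>i. i \<le> n \<Longrightarrow> x i \<in> Ob K" "\<And>i j. i \<le> j \<Longrightarrow> j \<le> n \<Longrightarrow> f (i, j) \<in> Hom K (x i) (x j)"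
  using assms by (fastforce simp: nerve_def ordinal_arrows_def PiE_def Pi_def)+

lemma step_fun_Ob:
  assumes "p \<in> topspace (cell_space K)" "0 \<le> r" "r < 1"
  shows "step_fun p r \<in> Ob K"
proof -
  obtain n x f t where p: "p = (n, (x, f), t)"
    by (metis surj_pair)
  then have x: "(x, f) \<in> nerve K n" and t: "t \<in> standard_simplex n"
    using assms by (auto simp: mem_cell_space)
  show ?thesis
    using nerve_D(1)[OF x] step_index(1)[OF t assms(2,3)]
    by (simp add: p step_fun_eq[OF t assms(2,3) step_index(2,3)[OF t assms(2,3)]])
qed

section \<open>Compatibility of step functions with the gluing relation\<close>

lemma nerve_pull_in_nerve:
  assumes \<sigma>: "\<sigma> \<in> nerve K n" and \<theta>: "mono_on {..m} \<theta>" "\<theta> ` {..m} \<subseteq> {..n}"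
  shows "nerve_pull m \<theta> \<sigma> \<in> nerve K m"
proof -
  obtain x f where s: "\<sigma> = (x, f)" by (cases \<sigma>)
  have le: "i \<le> m \<Longrightarrow> \<theta> i \<le> n" for i using \<theta> by auto
  have mo: "i \<le> j \<Longrightarrow> j \<le> m \<Longrightarrow> \<theta> i \<le> \<theta> j" for i j using \<theta>(1) by (auto simp: mono_on_def)
  note D = nerve_D[OF \<sigma>[unfolded s]]
  have id: "f (i, i) = Ident K (x i)" if "i \<le> n" for i
    using \<sigma> that by (auto simp: s nerve_def)
  have cp: "f (i, k) = Comp K (x i) (x j) (x k) (f (j, k)) (f (i, j))"
    if "i \<le> j" "j \<le> k" "k \<le> n" for i j k
    using \<sigma> that by (auto simp: s nerve_def)
  have "(\<lambda>i\<in>{..m}. x (\<theta> i), \<lambda>(i, j)\<in>ordinal_arrows m. f (\<theta> i, \<theta> j)) \<in> nerve K m"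
    unfolding nerve_def mem_Collect_eq prod.case
  proof (intro conjI allI impI)
    fix i j k assume "i \<le> j \<and> j \<le> k \<and> k \<le> m"
    then show "(\<lambda>(i, j)\<in>ordinal_arrows m. f (\<theta> i, \<theta> j)) (i, k) =
      Comp K ((\<lambda>i\<in>{..m}. x (\<theta> i)) i) ((\<lambda>i\<in>{..m}. x (\<theta> i)) j) ((\<lambda>i\<in>{..m}. x (\<theta> i)) k)
        ((\<lambda>(i, j)\<in>ordinal_arrows m. f (\<theta> i, \<theta> j)) (j, k))
        ((\<lambda>(i, j)\<in>ordinal_arrows m. f (\<theta> i, \<theta> j)) (i, j))"
      using cp[OF mo[of i j] mo[of j k] le[of k]] by (simp add: ordinal_arrows_def)
  qed (use D le mo id in \<open>auto simp: ordinal_arrows_def\<close>)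
  then show ?thesis by (simp add: nerve_pull_def s)
qed

lemma sum_simplex_push:
  assumes "finite A"
  shows "sum (simplex_push m \<theta> t) A = sum t {i. i \<le> m \<and> \<theta> i \<in> A}"
proof -
  have "sum (simplex_push m \<theta> t) A = sum t (\<Union>j\<in>A. {i. i \<le> m \<and> \<theta> i = j})"
    unfolding simplex_push_def by (subst sum.UNION_disjoint) (use assms in auto)
  also have "(\<Union>j\<in>A. {i. i \<le> m \<and> \<theta> i = j}) = {i. i \<le> m \<and> \<theta> i \<in> A}" by auto
  finally show ?thesis .
qed

lemma simplex_push_in_simplex:
  assumes t: "t \<in> standard_simplex m" and \<theta>: "\<theta> ` {..m} \<subseteq> {..n}"
  shows "simplex_push m \<theta> t \<in> standard_simplex n"
proof -
  have t0: "0 \<le> t i" for i using t by (simp add: standard_simplex_def)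
  have t1: "sum t {..m} = 1" using t by (simp add: standard_simplex_def)
  have "simplex_push m \<theta> t j \<ge> 0" for j
    unfolding simplex_push_def by (rule sum_nonneg) (rule t0)
  moreover have "simplex_push m \<theta> t j \<le> 1" for j
    unfolding simplex_push_def t1[symmetric] by (rule sum_mono2) (auto simp: t0)
  moreover have "simplex_push m \<theta> t j = 0" if "j > n" for j
    unfolding simplex_push_def by (rule sum.neutral) (use \<theta> that in auto)
  moreover have "sum (simplex_push m \<theta> t) {..n} = 1"
  proof -
    have "{i. i \<le> m \<and> \<theta> i \<in> {..n}} = {..m}" using \<theta> by auto
    then show ?thesis by (simp add: sum_simplex_push t1)
  qed
  ultimately show ?thesis
    by (simp add: standard_simplex_def)
qed

lemma glue_in_cell_space:
  assumes "glue K p q"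
  shows "p \<in> topspace (cell_space K)" "q \<in> topspace (cell_space K)"
  using assms by (auto simp: glue_def mem_cell_space simplex_push_in_simplex nerve_pull_in_nerve)

text \<open>Monotonicity of \<theta> puts the j-th interval of t inside the interval of the pushed
  coordinates with number \<open>\<theta> j\<close>, and both carry the vertex
  \<open>\<theta> j\<close> of \<sigma>. A pushforward merges neighbouring intervals with equal
  values and inserts empty ones for the vertices that \<theta> misses.\<close>

lemma step_fun_glue:
  assumes "glue K p q"
  shows "step_fun p = step_fun q"
proof -
  from assms obtain m n \<theta> \<sigma> t where t: "t \<in> standard_simplex m"
    and \<theta>: "mono_on {..m} \<theta>" "\<theta> ` {..m} \<subseteq> {..n}"
    and p: "p = (m, nerve_pull m \<theta> \<sigma>, t)" and q: "q = (n, \<sigma>, simplex_push m \<theta> t)"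
    by (auto simp: glue_def)
  have t0: "0 \<le> t i" for i using t by (simp add: standard_simplex_def)
  show ?thesis
  proof (rule step_fun_eqI)
    fix r :: real assume r: "0 \<le> r" "r < 1"
    obtain j where j: "j \<le> m" "sum t {..<j} \<le> r" "r < sum t {..j}"
      using step_index[OF t r] by blast
    have "sum (simplex_push m \<theta> t) {..<\<theta> j} \<le> sum t {..<j}"
    proof -
      have "i < j" if "i \<le> m" "\<theta> i < \<theta> j" for i
        using \<theta>(1) that j(1) by (meson atMost_iff linorder_not_less mono_onD)
      then show ?thesis
        by (auto simp: sum_simplex_push t0 intro!: sum_mono2)
    qed
    moreover have "sum t {..j} \<le> sum (simplex_push m \<theta> t) {..\<theta> j}"
    proof -
      have "\<theta> i \<le> \<theta> j" if "i \<le> j" for i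
        using \<theta>(1) that j(1) by (auto simp: mono_on_def)
      then show ?thesis
        using j(1) by (auto simp: sum_simplex_push t0 intro!: sum_mono2)
    qed
    ultimately have "step_fun q r = fst \<sigma> (\<theta> j)"
      unfolding q using r j by (intro step_fun_eq simplex_push_in_simplex[OF t \<theta>(2)]) auto
    moreover have "step_fun p r = fst \<sigma> (\<theta> j)"
      unfolding p step_fun_eq[OF t r j(2,3)] using j by (cases \<sigma>) (simp add: nerve_pull_def)
    ultimately show "step_fun p r = step_fun q r" by simp
  qed
qed

lemma step_fun_equivclp:
  assumes "equivclp (glue K) p q"
  shows "step_fun p = step_fun q"
  using assms by (induction rule: equivclp_induct) (auto dest: step_fun_glue)

lemma equivclp_glue_in_cell_space:
  assumes "equivclp (glue K) p q" "p \<in> topspace (cell_space K)"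
  shows "q \<in> topspace (cell_space K)"
  using assms by (induction rule: equivclp_induct) (auto dest: glue_in_cell_space)


section \<open>Thin categories\<close>

text \<open>The unit and associativity laws are equations between parallel arrows, so they are
  contained in \<open>thin\<close>.\<close>

locale thin_cat =
  fixes K :: "('o, 'f) small_cat"
  assumes Ident_in_Hom: "x \<in> Ob K \<Longrightarrow> Ident K x \<in> Hom K x x"
    and Comp_in_Hom: "\<lbrakk>x \<in> Ob K; y \<in> Ob K; z \<in> Ob K; f \<in> Hom K x y; g \<in> Hom K y z\<rbrakk>
      \<Longrightarrow> Comp K x y z g f \<in> Hom K x z"
    and thin: "\<lbrakk>x \<in> Ob K; y \<in> Ob K; f \<in> Hom K x y; f' \<in> Hom K x y\<rbrakk> \<Longrightarrow> f = f'"

definition reach :: "('o, 'f) small_cat \<Rightarrow> 'o \<Rightarrow> 'o \<Rightarrow> bool" where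
  "reach K x y \<longleftrightarrow> Hom K x y \<noteq> {}"

definition chain :: "('o, 'f) small_cat \<Rightarrow> nat \<Rightarrow> (nat \<Rightarrow> 'o) \<Rightarrow> ('o, 'f) nerve_simplex" where
  "chain K n x = (\<lambda>i\<in>{..n}. x i, \<lambda>(i, j)\<in>ordinal_arrows n. SOME f. f \<in> Hom K (x i) (x j))"

context thin_cat
begin

lemma reach_refl: "x \<in> Ob K \<Longrightarrow> reach K x x"
  using Ident_in_Hom by (auto simp: reach_def)

lemma reach_trans:
  "\<lbrakk>x \<in> Ob K; y \<in> Ob K; z \<in> Ob K; reach K x y; reach K y z\<rbrakk> \<Longrightarrow> reach K x z"
  using Comp_in_Hom by (fastforce simp: reach_def)

text \<open>The other conditions on a simplex equate parallel arrows and are automatic here.\<close>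

lemma nerve_iff:
  "(x, f) \<in> nerve K n \<longleftrightarrow> x \<in> {..n} \<rightarrow>\<^sub>E Ob K \<and>
     f \<in> (\<Pi>\<^sub>E (i, j) \<in> ordinal_arrows n. Hom K (x i) (x j))"
    (is "_ \<longleftrightarrow> ?x \<and> ?f")
proof
  assume "?x \<and> ?f"
  then have x: "\<And>i. i \<le> n \<Longrightarrow> x i \<in> Ob K"
    and f: "\<And>i j. i \<le> j \<Longrightarrow> j \<le> n \<Longrightarrow> f (i, j) \<in> Hom K (x i) (x j)"
    by (auto simp: ordinal_arrows_def)
  show "(x, f) \<in> nerve K n"
    unfolding nerve_def mem_Collect_eq prod.case
  proof (intro conjI allI impI)
    fix i assume "i \<le> n"
    then show "f (i, i) = Ident K (x i)"
      using x f Ident_in_Hom by (intro thin[of "x i" "x i"]) auto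
  next
    fix i j k assume *: "i \<le> j \<and> j \<le> k \<and> k \<le> n"
    show "f (i, k) = Comp K (x i) (x j) (x k) (f (j, k)) (f (i, j))"
      by (rule thin[of "x i" "x k"]) (use * x f in \<open>auto intro!: Comp_in_Hom\<close>)
  qed (use \<open>?x \<and> ?f\<close> in auto)
qed (simp add: nerve_def)

lemma nerve_eqI:
  assumes "\<sigma> \<in> nerve K n" "\<tau> \<in> nerve K n" "fst \<sigma> = fst \<tau>"
  shows "\<sigma> = \<tau>"
proof -
  obtain x f g where s: "\<sigma> = (x, f)" "\<tau> = (x, g)"
    using assms(3) by (metis prod.collapse)
  have "f = g"
  proof (rule extensionalityI)
    show "f \<in> extensional (ordinal_arrows n)" "g \<in> extensional (ordinal_arrows n)"
      using assms by (auto simp: s nerve_def PiE_def)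
    fix p assume "p \<in> ordinal_arrows n"
    then obtain i j where p: "p = (i, j)" and ij: "i \<le> j" "j \<le> n"
      by (auto simp: ordinal_arrows_def)
    show "f p = g p"
      unfolding p using assms ij by (intro thin[of "x i" "x j"]) (auto simp: s nerve_D)
  qed
  then show ?thesis by (simp add: s)
qed

lemma chain_in_nerve:
  assumes "\<And>i. i \<le> n \<Longrightarrow> x i \<in> Ob K" "\<And>i j. i \<le> j \<Longrightarrow> j \<le> n \<Longrightarrow> reach K (x i) (x j)"
  shows "chain K n x \<in> nerve K n"
  using assms unfolding chain_def nerve_iff
  by (auto simp: ordinal_arrows_def reach_def some_in_eq)

end

section \<open>Common refinements of cell points\<close>

text \<open>
  Two cell points with the same step function are glued to a common refinement, whose vertices are
  the values of the step function at the elements of a finite set B containing all breakpoints and 1.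
\<close>

definition refine_dim :: "real set \<Rightarrow> nat" where
  "refine_dim B = card B - 2"

definition refine_coord :: "real set \<Rightarrow> nat \<Rightarrow> real" where
  "refine_coord B i =
     (if i \<le> refine_dim B then sorted_list_of_set B ! Suc i - sorted_list_of_set B ! i else 0)"

text \<open>The map \<theta> sends a point of B to the interval of t that contains it. As B contains
  every breakpoint of t, no gap of B straddles two intervals, so adding up the gaps over the fibres
  of \<theta> gives back t. Dimension and coordinates of the refinement depend on B alone, and its
  vertices only on B and the step function, which lets two cell points share it.\<close>

lemma glue_refine:
  assumes \<sigma>: "\<sigma> \<in> nerve K n" and t: "t \<in> standard_simplex n"
    and B: "finite B" "B \<subseteq> {0..1}" "\<And>i. i \<le> Suc n \<Longrightarrow> sum t {..<i} \<in> B"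
  obtains \<tau> where "glue K (refine_dim B, \<tau>, refine_coord B) (n, \<sigma>, t)"
    "fst \<tau> = (\<lambda>i\<in>{..refine_dim B}. step_fun (n, \<sigma>, t) (sorted_list_of_set B ! i))"
proof -
  define b where "b = (!) (sorted_list_of_set B)"
  define M where "M = refine_dim B"
  define u where "u = refine_coord B"
  define \<theta> where "\<theta> = (\<lambda>i. LEAST j. b i < sum t {..j})"
  have t0: "0 \<le> t i" for i using t by (simp add: standard_simplex_def)
  have tn: "t i = 0" if "n < i" for i using t that by (simp add: standard_simplex_def)
  have t1: "sum t {..n} = 1" using t by (simp add: standard_simplex_def)
  have B01: "0 \<in> B" "1 \<in> B"
    using B(3)[of 0] B(3)[of "Suc n"] t1 by (auto simp: lessThan_Suc_atMost)
  \<comment> \<open>B has M + 2 points: they cut [0, 1] into M + 1 gaps, one for each vertex. The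
    two points 0 and 1 keep the truncated subtraction in \<open>refine_dim\<close> exact.\<close>
  have "card {0, 1 :: real} \<le> card B"
    using B01 B by (intro card_mono) auto
  then have len: "length (sorted_list_of_set B) = M + 2"
    by (simp add: M_def refine_dim_def)
  have b_mono: "b i < b j" if "i < j" "j \<le> Suc M" for i j
    using that len unfolding b_def
    by (intro sorted_wrt_nth_less[OF strict_sorted_list_of_set]) auto
  have b_mono': "b i \<le> b j" if "i \<le> j" "j \<le> Suc M" for i j
    using b_mono[of i j] that by (cases "i = j") auto
  have b_less_iff: "b i < b j \<longleftrightarrow> i < j" if "i \<le> Suc M" "j \<le> Suc M" for i j
    using b_mono[of i j] b_mono'[of j i] that by (metis linorder_not_less)
  have b_mem: "b i \<in> B" if "i \<le> Suc M" for i
    using that len B(1) unfolding b_def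
    by (metis add_2_eq_Suc' le_imp_less_Suc nth_mem set_sorted_list_of_set)
  have b_surj: "\<exists>i \<le> Suc M. b i = r" if "r \<in> B" for r
    using that len B(1) unfolding b_def
    by (metis add_2_eq_Suc' in_set_conv_nth less_Suc_eq_le set_sorted_list_of_set)
  have b0: "b 0 = 0"
    using b_surj[OF B01(1)] b_mono'[of 0] b_mem[of 0] B(2) by (force simp: subset_iff)
  have bM: "b (Suc M) = 1"
    using b_surj[OF B01(2)] b_mono'[of _ "Suc M"] b_mem[of "Suc M"] B(2) by (force simp: subset_iff)
  have b_range: "0 \<le> b i" "b i < 1" if "i \<le> M" for i
    using b_mono'[of 0 i] b_mono[of i "Suc M"] that b0 bM by auto
  have u_sum: "sum u {..<i} = b i" if "i \<le> Suc M" for i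
  proof -
    have "sum u {..<i} = (\<Sum>k<i. b (Suc k) - b k)"
      using that by (intro sum.cong) (auto simp: u_def refine_coord_def b_def M_def)
    then show ?thesis by (simp add: sum_lessThan_telescope b0)
  qed
  have u0: "0 \<le> u i" for i
    using b_mono'[of i "Suc i"] by (auto simp: u_def refine_coord_def b_def M_def)
  have u_simplex: "u \<in> standard_simplex M"
  proof -
    have s1: "sum u {..M} = 1"
      using u_sum[of "Suc M"] bM by (simp add: lessThan_Suc_atMost)
    have "u i \<le> 1" for i
    proof (cases "i \<le> M")
      case True
      then show ?thesis using member_le_sum[of i "{..M}" u] u0 s1 by auto
    qed (simp add: u_def refine_coord_def M_def)
    then show ?thesis
      using s1 u0 by (auto simp: standard_simplex_def) (auto simp: u_def refine_coord_def M_def)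
  qed
  have \<theta>: "\<theta> i \<le> n" "sum t {..<\<theta> i} \<le> b i" "b i < sum t {..\<theta> i}" if "i \<le> M" for i
    using step_index[OF t b_range[OF that]] by (auto simp: \<theta>_def)
  have \<theta>_less_iff: "\<theta> i < j \<longleftrightarrow> b i < sum t {..<j}" if "i \<le> M" for i j
  proof
    assume "\<theta> i < j"
    then have "sum t {..\<theta> i} \<le> sum t {..<j}" by (intro sum_mono2) (auto simp: t0)
    then show "b i < sum t {..<j}" using \<theta>(3)[OF that] by linarith
  next
    assume *: "b i < sum t {..<j}"
    show "\<theta> i < j"
    proof (rule ccontr)
      assume "\<not> \<theta> i < j"
      then have "sum t {..<j} \<le> sum t {..<\<theta> i}" by (intro sum_mono2) (auto simp: t0)
      then show False using * \<theta>(2)[OF that] by linarith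
    qed
  qed
  have mono: "mono_on {..M} \<theta>"
  proof (rule mono_onI)
    fix i j assume "i \<in> {..M}" "j \<in> {..M}" "i \<le> j"
    then have "b i < sum t {..<Suc (\<theta> j)}"
      using b_mono'[of i j] \<theta>(3)[of j] by (auto simp: lessThan_Suc_atMost)
    then show "\<theta> i \<le> \<theta> j"
      using \<theta>_less_iff[of i "Suc (\<theta> j)"] \<open>i \<in> {..M}\<close> by simp
  qed
  \<comment> \<open>The indices i with \<open>\<theta> i < j\<close> are those of the points of B
    below the breakpoint \<open>b p\<close>, and their gaps telescope to \<open>b p\<close>.\<close>
  have partial: "sum (simplex_push M \<theta> u) {..<j} = sum t {..<j}" if j: "j \<le> Suc n" for j
  proof -
    obtain p where p: "p \<le> Suc M" "b p = sum t {..<j}"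
      using b_surj[OF B(3)[OF j]] by auto
    have "{i. i \<le> M \<and> \<theta> i \<in> {..<j}} = {..<p}"
      using \<theta>_less_iff p b_less_iff[of _ p] by auto
    then show ?thesis
      by (simp add: sum_simplex_push u_sum p)
  qed
  have push: "simplex_push M \<theta> u = t"
  proof
    fix j
    show "simplex_push M \<theta> u j = t j"
    proof (cases "j \<le> n")
      case True
      then show ?thesis using partial[of j] partial[of "Suc j"] by simp
    next
      case False
      then have "{i. i \<le> M \<and> \<theta> i = j} = {}" using \<theta>(1) by auto
      then have "simplex_push M \<theta> u j = 0" unfolding simplex_push_def by (simp only: sum.empty)
      then show ?thesis using False tn by simp
    qed
  qed
  have "glue K (M, nerve_pull M \<theta> \<sigma>, u) (n, \<sigma>, t)"
    unfolding glue_def using \<sigma> u_simplex mono \<theta>(1) push by blast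
  moreover have "fst (nerve_pull M \<theta> \<sigma>) = (\<lambda>i\<in>{..M}. step_fun (n, \<sigma>, t) (b i))"
    using step_fun_eq[OF t b_range \<theta>(2,3), of _ \<sigma>]
    by (cases \<sigma>) (auto simp: nerve_pull_def intro!: restrict_ext)
  ultimately show ?thesis
    using that by (simp add: M_def u_def b_def)
qed

context thin_cat
begin

text \<open>For the converse, B consists of the breakpoints of both points. The two refinements then
  have the same vertices, and in a thin category these determine the simplex, so p and q are glued
  to one and the same cell point.\<close>

lemma equivclp_glue_iff:
  assumes "p \<in> topspace (cell_space K)" "q \<in> topspace (cell_space K)"
  shows "equivclp (glue K) p q \<longleftrightarrow> step_fun p = step_fun q"
proof
  assume eq: "step_fun p = step_fun q"
  obtain n \<sigma> t where p: "p = (n, \<sigma>, t)" by (cases p)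
  obtain m \<tau> u where q: "q = (m, \<tau>, u)" by (cases q)
  have \<sigma>: "\<sigma> \<in> nerve K n" and t: "t \<in> standard_simplex n"
    and \<tau>: "\<tau> \<in> nerve K m" and u: "u \<in> standard_simplex m"
    using assms by (auto simp: p q mem_cell_space)
  define B where "B = (\<lambda>i. sum t {..<i}) ` {..Suc n} \<union> (\<lambda>i. sum u {..<i}) ` {..Suc m}"
  have B: "finite B" by (simp add: B_def)
  have partial: "sum v {..<i} \<in> {0..1}" if "v \<in> standard_simplex k" "i \<le> Suc k" for v k i
  proof -
    have "sum v {..<i} \<le> sum v {..k}"
      using that by (intro sum_mono2) (auto simp: standard_simplex_def)
    then show ?thesis
      using that by (auto simp: standard_simplex_def intro: sum_nonneg)
  qed
  have B01: "B \<subseteq> {0..1}"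
    using partial[OF t] partial[OF u] by (auto simp: B_def)
  obtain \<rho> where \<rho>: "glue K (refine_dim B, \<rho>, refine_coord B) p"
    "fst \<rho> = (\<lambda>i\<in>{..refine_dim B}. step_fun p (sorted_list_of_set B ! i))"
    unfolding p by (rule glue_refine[OF \<sigma> t B B01]) (auto simp: B_def)
  obtain \<rho>' where \<rho>': "glue K (refine_dim B, \<rho>', refine_coord B) q"
    "fst \<rho>' = (\<lambda>i\<in>{..refine_dim B}. step_fun q (sorted_list_of_set B ! i))"
    unfolding q by (rule glue_refine[OF \<tau> u B B01]) (auto simp: B_def)
  have "\<rho> = \<rho>'"
    using glue_in_cell_space(1)[OF \<rho>(1)] glue_in_cell_space(1)[OF \<rho>'(1)] \<rho>(2) \<rho>'(2) eq
    by (intro nerve_eqI) (auto simp: mem_cell_space)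
  then show "equivclp (glue K) p q"
    using \<rho>(1) \<rho>'(1) by (meson converse_r_into_equivclp equivclp_trans r_into_equivclp)
qed (rule step_fun_equivclp)

end


section \<open>Points of the realization of a thin category\<close>

text \<open>The equivalence class, described as a fibre of \<open>step_fun\<close>. It is empty if
  no cell point realizes w, so recovering w from \<open>point K w\<close> requires a
  representative.\<close>

definition point :: "('o, 'f) small_cat \<Rightarrow> (real \<Rightarrow> 'o) \<Rightarrow> ('o, 'f) cell_point set" where
  "point K w = {p \<in> topspace (cell_space K). step_fun p = w}"

definition step_of :: "('o, 'f) cell_point set \<Rightarrow> real \<Rightarrow> 'o" where
  "step_of S = step_fun (SOME p. p \<in> S)"

lemma step_of_point: "p \<in> topspace (cell_space K) \<Longrightarrow> step_of (point K (step_fun p)) = step_fun p"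
  unfolding step_of_def by (rule someI2[of _ p]) (auto simp: point_def)

context thin_cat
begin

lemma realization_class_eq:
  assumes "p \<in> topspace (cell_space K)"
  shows "realization_class K p = point K (step_fun p)"
  unfolding realization_class_def point_def
  using assms equivclp_glue_iff[OF assms] equivclp_glue_in_cell_space[of K p] by metis

lemma quotient_map_point:
  "quotient_map (cell_space K) (realization K) (\<lambda>p. point K (step_fun p))"
proof (rule quotient_map_eq)
  show "quotient_map (cell_space K) (realization K) (realization_class K)"
    unfolding realization_def by (rule quotient_map_quotient_topology)
qed (rule realization_class_eq)

lemma topspace_realization:
  "topspace (realization K) = (\<lambda>p. point K (step_fun p)) ` topspace (cell_space K)"
  using quotient_map_point by (simp add: quotient_map_def)

lemma point_step_of:
  "S \<in> topspace (realization K) \<Longrightarrow> point K (step_of S) = S"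
  by (auto simp: topspace_realization step_of_point)

lemma step_of_Ob:
  "S \<in> topspace (realization K) \<Longrightarrow> 0 \<le> r \<Longrightarrow> r < 1 \<Longrightarrow> step_of S r \<in> Ob K"
  by (auto simp: topspace_realization step_of_point step_fun_Ob)

lemma step_of_undefined:
  "S \<in> topspace (realization K) \<Longrightarrow> r \<notin> {0..<1} \<Longrightarrow> step_of S r = undefined"
  by (auto simp: topspace_realization step_of_point step_fun_undefined)

end

text \<open>The cut at a = 0 leaves only \<psi>, so \<open>mix \<psi> \<psi> 0\<close> is
  composition with \<psi>, kept undefined outside [0, 1); it describes the map induced by a
  functor.\<close>

definition mix :: "('o \<Rightarrow> 'p) \<Rightarrow> ('o \<Rightarrow> 'p) \<Rightarrow> real \<Rightarrow> (real \<Rightarrow> 'o) \<Rightarrow> real \<Rightarrow> 'p" where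
  "mix \<phi> \<psi> a w = (\<lambda>r\<in>{0..<1}. if r < a then \<phi> (w r) else \<psi> (w r))"

lemma mix_cong:
  assumes "\<And>r. 0 \<le> r \<Longrightarrow> r < 1 \<Longrightarrow> \<phi> (w r) = \<phi>' (w' r)"
    "\<And>r. 0 \<le> r \<Longrightarrow> r < 1 \<Longrightarrow> \<psi> (w r) = \<psi>' (w' r)"
  shows "mix \<phi> \<psi> a w = mix \<phi>' \<psi>' a w'"
  using assms by (auto simp: mix_def)

lemma mix_1: "mix \<phi> \<psi> 1 w = mix \<phi> \<phi> 0 w"
  and mix_0: "mix \<phi> \<psi> 0 w = mix \<psi> \<psi> 0 w"
  by (auto simp: mix_def)

definition monotone_on_reach ::
    "('o, 'f) small_cat \<Rightarrow> ('p, 'h) small_cat \<Rightarrow> ('o \<Rightarrow> 'p) \<Rightarrow> bool" where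
  "monotone_on_reach K L \<phi> \<longleftrightarrow> \<phi> \<in> Ob K \<rightarrow> Ob L \<and>
     (\<forall>x\<in>Ob K. \<forall>y\<in>Ob K. reach K x y \<longrightarrow> reach L (\<phi> x) (\<phi> y))"


section \<open>Prisms\<close>

text \<open>The standard triangulation of a prism in coordinates: if a lies in the j-th interval of
  t, that interval is cut at a and the j-th vertex is used twice, under \<phi> for the left part and
  under \<psi> for the right part.\<close>

definition prism_coord :: "nat \<Rightarrow> real \<Rightarrow> (nat \<Rightarrow> real) \<Rightarrow> nat \<Rightarrow> real" where
  "prism_coord j a t i =
     (if i < j then t i else if i = j then a - sum t {..<j}
      else if i = Suc j then sum t {..j} - a else t (i - 1))"

definition prism_vertex :: "nat \<Rightarrow> ('o \<Rightarrow> 'p) \<Rightarrow> ('o \<Rightarrow> 'p) \<Rightarrow> (nat \<Rightarrow> 'o) \<Rightarrow> nat \<Rightarrow> 'p" where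
  "prism_vertex j \<phi> \<psi> x i = (if i \<le> j then \<phi> (x i) else \<psi> (x (i - 1)))"

text \<open>The breakpoints are those of t with a inserted at position j + 1.\<close>

lemma sum_prism_coord:
  "sum (prism_coord j a t) {..<i} =
     (if i \<le> j then sum t {..<i} else if i = Suc j then a else sum t {..<i - 1})"
proof (induction i)
  case (Suc i)
  show ?case
  proof (cases "i = Suc j")
    case False
    then show ?thesis
      using Suc by (cases i; cases j) (auto simp: prism_coord_def lessThan_Suc)
  qed (use Suc in \<open>simp add: prism_coord_def lessThan_Suc_atMost\<close>)
qed simp

context
  fixes n j :: nat and a :: real and t :: "nat \<Rightarrow> real"
  assumes t: "t \<in> standard_simplex n" and j: "j \<le> n"
    and a: "sum t {..<j} \<le> a" "a \<le> sum t {..j}"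
begin

lemma prism_coord_in_simplex: "prism_coord j a t \<in> standard_simplex (Suc n)"
proof -
  let ?u = "prism_coord j a t"
  have u0: "0 \<le> ?u i" for i
    using t a by (auto simp: prism_coord_def standard_simplex_def)
  have u1: "sum ?u {..Suc n} = 1"
    using t j sum_prism_coord[of j a t "Suc (Suc n)"]
    by (simp add: standard_simplex_def lessThan_Suc_atMost)
  have un: "?u i = 0" if "i > Suc n" for i
    using t j that by (auto simp: prism_coord_def standard_simplex_def)
  have "?u i \<le> 1" for i
  proof (cases "i \<le> Suc n")
    case True
    then show ?thesis using member_le_sum[of i "{..Suc n}" ?u] u0 u1 by simp
  qed (use un in simp)
  then show ?thesis
    using u0 u1 un by (simp add: standard_simplex_def)
qed

text \<open>An r < a lies in an interval of t with number k \<le> j, and this number is kept. For r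
  \<ge> a the number satisfies j \<le> k and moves up by one, because of the inserted
  breakpoint.\<close>

lemma step_fun_prism:
  assumes x: "fst \<tau> = restrict (prism_vertex j \<phi> \<psi> (fst \<sigma>)) {..Suc n}"
  shows "step_fun (Suc n, \<tau>, prism_coord j a t) = mix \<phi> \<psi> a (step_fun (n, \<sigma>, t))"
proof
  fix r
  show "step_fun (Suc n, \<tau>, prism_coord j a t) r = mix \<phi> \<psi> a (step_fun (n, \<sigma>, t)) r"
  proof (cases "r \<in> {0..<1}")
    case True
    then have r: "0 \<le> r" "r < 1" by auto
    have t0: "0 \<le> t i" for i using t by (simp add: standard_simplex_def)
    have mono: "sum t {..<i} \<le> sum t {..<k}" if "i \<le> k" for i k
      using that by (intro sum_mono2) (auto simp: t0)
    obtain k where k: "k \<le> n" "sum t {..<k} \<le> r" "r < sum t {..k}"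
      using step_index[OF t r] by blast
    note w = step_fun_eq[OF t r k(2,3), of \<sigma>]
    note a' = a[folded lessThan_Suc_atMost] and k' = k[folded lessThan_Suc_atMost]
    show ?thesis
    proof (cases "r < a")
      case True
      then have "k \<le> j" using mono[of "Suc j" k] a' k' by force
      then have "step_fun (Suc n, \<tau>, prism_coord j a t) r = fst \<tau> k"
        using True a' k'
        by (intro step_fun_eq[OF prism_coord_in_simplex r])
          (auto simp: sum_prism_coord simp del: sum.lessThan_Suc simp flip: lessThan_Suc_atMost)
      then show ?thesis
        using \<open>k \<le> j\<close> True r k by (simp add: x mix_def w prism_vertex_def)
    next
      case False
      then have "j \<le> k" using mono[of "Suc k" j] a' k' by force
      then have "step_fun (Suc n, \<tau>, prism_coord j a t) r = fst \<tau> (Suc k)"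
        using False a' k'
        by (intro step_fun_eq[OF prism_coord_in_simplex r])
          (auto simp: sum_prism_coord simp del: sum.lessThan_Suc simp flip: lessThan_Suc_atMost)
      then show ?thesis
        using \<open>j \<le> k\<close> False r k by (simp add: x mix_def w prism_vertex_def)
    qed
  qed (auto simp: mix_def step_fun_undefined)
qed

end

text \<open>The comparison of \<phi> with \<psi> is needed for the passage between the two halves:
  \<open>\<phi> (x i)\<close> reaches \<open>\<phi> (x k)\<close>, which reaches
  \<open>\<psi> (x k)\<close>.\<close>

lemma prism_in_nerve:
  assumes "thin_cat L" and \<sigma>: "\<sigma> \<in> nerve K n" and "j \<le> n"
    and \<phi>: "monotone_on_reach K L \<phi>" and \<psi>: "monotone_on_reach K L \<psi>"
    and le: "\<And>x. x \<in> Ob K \<Longrightarrow> reach L (\<phi> x) (\<psi> x)"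
  shows "chain L (Suc n) (prism_vertex j \<phi> \<psi> (fst \<sigma>)) \<in> nerve L (Suc n)"
proof -
  interpret L: thin_cat L by fact
  obtain x f where s: "\<sigma> = (x, f)" by (cases \<sigma>)
  have x: "x i \<in> Ob K" if "i \<le> n" for i
    using nerve_D(1)[OF \<sigma>[unfolded s]] that by blast
  have r: "reach K (x i) (x k)" if "i \<le> k" "k \<le> n" for i k
    using nerve_D(2)[OF \<sigma>[unfolded s]] that by (auto simp: reach_def)
  have ob: "\<phi> (x i) \<in> Ob L" "\<psi> (x i) \<in> Ob L" if "i \<le> n" for i
    using x[OF that] \<phi> \<psi> by (auto simp: monotone_on_reach_def)
  have m: "reach L (\<phi> (x i)) (\<phi> (x k))" "reach L (\<psi> (x i)) (\<psi> (x k))"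
    if "i \<le> k" "k \<le> n" for i k
    using x[of i] x[of k] r[OF that] that \<phi> \<psi> by (auto simp: monotone_on_reach_def)
  have m2: "reach L (\<phi> (x i)) (\<psi> (x k))" if "i \<le> k" "k \<le> n" for i k
    using that by (intro L.reach_trans[OF _ _ _ m(1)[of i k] le[of "x k"]] ob x) auto
  show ?thesis
    unfolding s fst_conv
  proof (rule L.chain_in_nerve)
    show "prism_vertex j \<phi> \<psi> x i \<in> Ob L" if "i \<le> Suc n" for i
      using that \<open>j \<le> n\<close> ob by (auto simp: prism_vertex_def)
    show "reach L (prism_vertex j \<phi> \<psi> x i) (prism_vertex j \<phi> \<psi> x k)"
      if "i \<le> k" "k \<le> Suc n" for i k
      using that \<open>j \<le> n\<close> m m2 by (auto simp: prism_vertex_def)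
  qed
qed


section \<open>Continuity of the homotopy\<close>

lemma openin_prod_discrete:
  assumes "U \<subseteq> D \<times> topspace T" "\<And>d. d \<in> D \<Longrightarrow> openin T {t. (d, t) \<in> U}"
  shows "openin (prod_topology (discrete_topology D) T) U"
proof -
  have "U = (\<Union>d\<in>D. {d} \<times> {t. (d, t) \<in> U})" using assms(1) by auto
  also have "openin (prod_topology (discrete_topology D) T) \<dots>"
    using assms(2) by (intro openin_Union) (auto simp: openin_prod_Times_iff)
  finally show ?thesis .
qed

abbreviation simplex_space :: "nat \<Rightarrow> (nat \<Rightarrow> real) topology" where
  "simplex_space n \<equiv> subtopology (powertop_real UNIV) (standard_simplex n)"

lemma continuous_map_from_cell_space:
  assumes "\<And>n \<sigma>. \<sigma> \<in> nerve K n \<Longrightarrow> continuous_map (simplex_space n) Y (\<lambda>t. f (n, \<sigma>, t))"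
  shows "continuous_map (cell_space K) Y f"
  unfolding continuous_map_def
proof (intro conjI allI impI)
  show "f \<in> topspace (cell_space K) \<rightarrow> topspace Y"
  proof
    fix p assume p: "p \<in> topspace (cell_space K)"
    obtain n \<sigma> t where [simp]: "p = (n, \<sigma>, t)" by (cases p)
    show "f p \<in> topspace Y"
      using p continuous_map_image_subset_topspace[OF assms[of \<sigma> n]] by (auto simp: mem_cell_space)
  qed
  fix U assume U: "openin Y U"
  have "openin (prod_topology (discrete_topology (nerve K n)) (simplex_space n))
      {x. (n, x) \<in> {p \<in> topspace (cell_space K). f p \<in> U}}" for n
  proof (rule openin_prod_discrete)
    fix \<sigma> assume "\<sigma> \<in> nerve K n"
    then show "openin (simplex_space n)
       {t. (\<sigma>, t) \<in> {x. (n, x) \<in> {p \<in> topspace (cell_space K). f p \<in> U}}}"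
      using openin_continuous_map_preimage[OF assms U, of \<sigma> n] by (simp add: mem_cell_space)
  qed (auto simp: mem_cell_space)
  then show "openin (cell_space K) {p \<in> topspace (cell_space K). f p \<in> U}"
    by (subst cell_space_def) (auto simp: openin_sum_topology mem_cell_space)
qed

lemma continuous_map_cell_inclusion:
  assumes "\<sigma> \<in> nerve K n"
  shows "continuous_map (simplex_space n) (cell_space K) (\<lambda>t. (n, \<sigma>, t))"
proof -
  have "continuous_map (simplex_space n)
      (prod_topology (discrete_topology (nerve K n)) (simplex_space n)) (\<lambda>t. (\<sigma>, t))"
    using assms by (intro continuous_map_pairedI) auto
  moreover have "continuous_map (prod_topology (discrete_topology (nerve K n)) (simplex_space n))
      (cell_space K) (\<lambda>p. (n, p))"
    unfolding cell_space_def by (rule continuous_map_component_injection) simp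
  ultimately show ?thesis
    using continuous_map_compose by (fastforce simp: o_def)
qed

text \<open>The preimage of a label is a single cell, which is thereby both open and closed.\<close>

lemma continuous_map_cell_label:
  "continuous_map (cell_space K) (discrete_topology UNIV) (\<lambda>p. (fst p, fst (snd p)))"
  by (rule continuous_map_from_cell_space) simp

lemma continuous_map_cell_coord:
  "continuous_map (cell_space K) euclideanreal (\<lambda>p. snd (snd p) i)"
  by (rule continuous_map_from_cell_space)
    (auto intro: continuous_map_from_subtopology continuous_map_product_projection)

text \<open>While a stays in the j-th interval of t, the formula runs through one prism simplex with
  coordinates affine in a and t. These closed pieces are finitely many over each cell, and since one
  formula defines the map on all of them, they agree where they overlap.\<close>

lemma continuous_map_mix_cell:
  assumes "thin_cat L"
    and \<phi>: "monotone_on_reach K L \<phi>" and \<psi>: "monotone_on_reach K L \<psi>"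
    and le: "\<And>x. x \<in> Ob K \<Longrightarrow> reach L (\<phi> x) (\<psi> x)"
  shows "continuous_map (prod_topology (top_of_set {0..1}) (cell_space K)) (realization L)
    (\<lambda>(a, p). point L (mix \<phi> \<psi> a (step_fun p)))"
    (is "continuous_map ?X _ ?g")
proof -
  interpret L: thin_cat L by fact
  have fst: "continuous_map ?X euclideanreal fst"
    using continuous_map_fst continuous_map_into_fulltopology by blast
  have snd: "continuous_map ?X (cell_space K) snd"
    by (rule continuous_map_snd)
  have coord: "continuous_map ?X euclideanreal (\<lambda>z. snd (snd (snd z)) i)" for i
    using continuous_map_compose[OF snd continuous_map_cell_coord] by (simp add: o_def)
  have label: "continuous_map ?X (discrete_topology UNIV) (\<lambda>z. (fst (snd z), fst (snd (snd z))))"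
    using continuous_map_compose[OF snd continuous_map_cell_label] by (simp add: o_def)
  define V where "V = (\<lambda>n \<sigma>. {z \<in> topspace ?X. (fst (snd z), fst (snd (snd z))) \<in> {(n, \<sigma>)}})"
  have V_open: "openin ?X (V n \<sigma>)" and V_closed: "closedin ?X (V n \<sigma>)" for n \<sigma>
    unfolding V_def
    by (rule openin_continuous_map_preimage[OF label] closedin_continuous_map_preimage[OF label], simp)+
  \<comment> \<open>Both inequalities are weak, so that the pieces are closed; neighbouring pieces
    share the points at which a is a breakpoint.\<close>
  define T where "T = (\<lambda>(n, \<sigma>, j). V n \<sigma> \<inter>
     ({z \<in> topspace ?X. fst z - sum (snd (snd (snd z))) {..<j} \<in> {0..}} \<inter>
     {z \<in> topspace ?X. sum (snd (snd (snd z))) {..j} - fst z \<in> {0..}}))"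
  define I where "I = {(n, \<sigma>, j). \<sigma> \<in> nerve K n \<and> j \<le> n}"
  have T_closed: "closedin ?X (T (n, \<sigma>, j))" for n \<sigma> j
    unfolding T_def prod.case
    by (intro closedin_Int V_closed closedin_continuous_map_preimage[of _ euclideanreal]
        continuous_intros fst coord) auto
  show ?thesis
  proof (rule pasting_lemma_locally_finite[where I = I and T = T and f = "\<lambda>_. ?g"])
    fix z assume z: "z \<in> topspace ?X"
    obtain a n \<sigma> t where zz: "z = (a, n, \<sigma>, t)" by (metis surj_pair)
    have "z \<in> V n \<sigma>" using z by (simp add: V_def zz)
    moreover have "{i \<in> I. T i \<inter> V n \<sigma> \<noteq> {}} \<subseteq> (\<lambda>j. (n, \<sigma>, j)) ` {..n}"
      by (auto simp: I_def T_def V_def)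
    then have "finite {i \<in> I. T i \<inter> V n \<sigma> \<noteq> {}}" by (rule finite_subset) simp
    ultimately show "\<exists>V. openin ?X V \<and> z \<in> V \<and> finite {i \<in> I. T i \<inter> V \<noteq> {}}"
      using V_open by blast
    have \<sigma>: "\<sigma> \<in> nerve K n" and t: "t \<in> standard_simplex n" and a: "0 \<le> a" "a \<le> 1"
      using z by (auto simp: zz mem_cell_space)
    \<comment> \<open>\<open>step_index\<close> asks for a < 1; at a = 1 the last interval
      serves.\<close>
    have "\<exists>j\<le>n. sum t {..<j} \<le> a \<and> a \<le> sum t {..j}"
    proof (cases "a = 1")
      case True
      then have "sum t {..<n} \<le> a" "a \<le> sum t {..n}"
        using sum_mono2[of "{..n}" "{..<n}" t] t by (force simp: standard_simplex_def)+
      then show ?thesis by blast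
    next
      case False
      then show ?thesis using step_index[OF t, of a] a by force
    qed
    then obtain j where "j \<le> n" "sum t {..<j} \<le> a" "a \<le> sum t {..j}" by blast
    then show "\<exists>j. j \<in> I \<and> z \<in> T j \<and> ?g z = ?g z"
      using \<open>z \<in> V n \<sigma>\<close> z \<sigma> by (intro exI[of _ "(n, \<sigma>, j)"]) (auto simp: I_def T_def zz)
  next
    fix i assume "i \<in> I"
    then obtain n \<sigma> j where i: "i = (n, \<sigma>, j)" and \<sigma>: "\<sigma> \<in> nerve K n" and j: "j \<le> n"
      by (auto simp: I_def)
    define \<tau> where "\<tau> = chain L (Suc n) (prism_vertex j \<phi> \<psi> (fst \<sigma>))"
    have \<tau>: "\<tau> \<in> nerve L (Suc n)"
      unfolding \<tau>_def by (rule prism_in_nerve[OF \<open>thin_cat L\<close> \<sigma> j \<phi> \<psi> le])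
    let ?u = "\<lambda>z. prism_coord j (fst z) (snd (snd (snd z)))"
    have T_D: "fst (snd z) = n \<and> fst (snd (snd z)) = \<sigma> \<and> snd (snd (snd z)) \<in> standard_simplex n \<and>
        sum (snd (snd (snd z))) {..<j} \<le> fst z \<and> fst z \<le> sum (snd (snd (snd z))) {..j}"
      if "z \<in> topspace (subtopology ?X (T i))" for z
      using that by (auto simp: i T_def V_def mem_cell_space)
    have "continuous_map ?X euclideanreal (\<lambda>z. ?u z k)" for k
      unfolding prism_coord_def
      by (cases "k < j"; cases "k = j"; cases "k = Suc j") (auto intro!: continuous_intros fst coord)
    then have "continuous_map ?X (powertop_real UNIV) ?u"
      by (simp add: continuous_map_componentwise_UNIV)
    then have "continuous_map (subtopology ?X (T i)) (simplex_space (Suc n)) ?u"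
      using T_D j prism_coord_in_simplex
      by (intro continuous_map_into_subtopology continuous_map_from_subtopology) blast+
    from continuous_map_compose[OF continuous_map_compose[OF this continuous_map_cell_inclusion[OF \<tau>]]
        quotient_imp_continuous_map[OF L.quotient_map_point]]
    show "continuous_map (subtopology ?X (T i)) (realization L) ?g"
    proof (rule continuous_map_eq)
      fix z assume "z \<in> topspace (subtopology ?X (T i))"
      note z = T_D[OF this]
      obtain a t where zz: "z = (a, n, \<sigma>, t)" using z by (metis prod.collapse)
      have "step_fun (Suc n, \<tau>, prism_coord j a t) = mix \<phi> \<psi> a (step_fun (n, \<sigma>, t))"
        by (rule step_fun_prism) (use z j in \<open>auto simp: zz \<tau>_def chain_def\<close>)
      then show "((\<lambda>p. point L (step_fun p)) \<circ> ((\<lambda>t. (Suc n, \<tau>, t)) \<circ> ?u)) z = ?g z"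
        by (simp add: zz)
    qed
  qed (auto simp: T_closed split_paired_all)
qed

text \<open>The unit interval is locally compact and Hausdorff, so its product with the quotient map
  onto the realization is still a quotient map, and continuity can be tested on cell points.\<close>

lemma continuous_map_mix:
  assumes "thin_cat K" "thin_cat L"
    and "monotone_on_reach K L \<phi>" "monotone_on_reach K L \<psi>"
    and "\<And>x. x \<in> Ob K \<Longrightarrow> reach L (\<phi> x) (\<psi> x)"
  shows "continuous_map (prod_topology (top_of_set {0..1}) (realization K)) (realization L)
    (\<lambda>(a, S). point L (mix \<phi> \<psi> a (step_of S)))"
    (is "continuous_map _ _ ?h")
proof -
  interpret K: thin_cat K by fact
  have "locally_compact_space (top_of_set {0..1::real})"
    by (intro compact_imp_locally_compact_space) (simp add: compact_space_subtopology)
  moreover have "Hausdorff_space (top_of_set {0..1::real})"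
    by (simp add: Hausdorff_space_subtopology)
  ultimately have q: "quotient_map (prod_topology (top_of_set {0..1::real}) (cell_space K))
     (prod_topology (top_of_set {0..1::real}) (realization K)) (\<lambda>(a, p). (a, point K (step_fun p)))"
    using quotient_map_prod_right[OF _ _ K.quotient_map_point] by blast
  show ?thesis
    by (rule continuous_compose_quotient_map[OF q],
        rule continuous_map_eq[OF continuous_map_mix_cell[OF assms(2-5)]])
      (auto simp: step_of_point)
qed


section \<open>Functors between thin categories\<close>

text \<open>If the target is thin, preservation of identities and composites is once more an
  equation between parallel arrows.\<close>

definition thin_functor ::
    "('o, 'f) small_cat \<Rightarrow> ('p, 'h) small_cat \<Rightarrow> ('o, 'f, 'p, 'h) cat_functor \<Rightarrow> bool" where
  "thin_functor K L \<Phi> \<longleftrightarrow> on_ob \<Phi> \<in> Ob K \<rightarrow> Ob L \<and>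
     (\<forall>x\<in>Ob K. \<forall>y\<in>Ob K. on_arr \<Phi> x y \<in> Hom K x y \<rightarrow> Hom L (on_ob \<Phi> x) (on_ob \<Phi> y))"

lemma thin_functor_monotone: "thin_functor K L \<Phi> \<Longrightarrow> monotone_on_reach K L (on_ob \<Phi>)"
  by (fastforce simp: thin_functor_def monotone_on_reach_def reach_def)

lemma thin_functor_of_monotone:
  fixes K :: "('o, 'f) small_cat" and L :: "('p, 'h) small_cat"
  assumes "monotone_on_reach K L \<phi>"
  obtains \<Phi> :: "('o, 'f, 'p, 'h) cat_functor" where "thin_functor K L \<Phi>" "on_ob \<Phi> = \<phi>"
proof
  define \<Phi> :: "('o, 'f, 'p, 'h) cat_functor" where "\<Phi> = \<lparr>on_ob = \<phi>, on_arr = (\<lambda>x y _. SOME f. f \<in> Hom L (\<phi> x) (\<phi> y))\<rparr>"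
  show "thin_functor K L \<Phi>"
    using assms by (fastforce simp: thin_functor_def monotone_on_reach_def reach_def \<Phi>_def some_in_eq)
  show "on_ob \<Phi> = \<phi>" by (simp add: \<Phi>_def)
qed

lemma nerve_map_in_nerve:
  assumes "thin_cat L" "thin_functor K L \<Phi>" "\<sigma> \<in> nerve K n"
  shows "nerve_map \<Phi> n \<sigma> \<in> nerve L n"
proof -
  interpret L: thin_cat L by fact
  obtain x f where s: "\<sigma> = (x, f)" by (cases \<sigma>)
  note D = nerve_D[OF assms(3)[unfolded s]]
  show ?thesis
    using D assms(2) unfolding s nerve_map_def prod.case L.nerve_iff thin_functor_def
    by (auto simp: ordinal_arrows_def Pi_iff)
qed

lemma step_fun_nerve_map:
  assumes "\<sigma> \<in> nerve K n" "t \<in> standard_simplex n"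
  shows "step_fun (n, nerve_map \<Phi> n \<sigma>, t) = mix (on_ob \<Phi>) (on_ob \<Phi>) 0 (step_fun (n, \<sigma>, t))"
proof
  fix r
  show "step_fun (n, nerve_map \<Phi> n \<sigma>, t) r =
    mix (on_ob \<Phi>) (on_ob \<Phi>) 0 (step_fun (n, \<sigma>, t)) r"
  proof (cases "r \<in> {0..<1}")
    case True
    then have r: "0 \<le> r" "r < 1" by auto
    show ?thesis
      using step_index(1)[OF assms(2) r] r
      by (cases \<sigma>)
        (simp add: mix_def nerve_map_def step_fun_eq[OF assms(2) r step_index(2,3)[OF assms(2) r]])
  qed (auto simp: mix_def step_fun_undefined)
qed

context
  fixes K :: "('o, 'f) small_cat" and L :: "('p, 'h) small_cat"
  assumes K: "thin_cat K" and L: "thin_cat L"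
begin

interpretation K: thin_cat K by (rule K)
interpretation L: thin_cat L by (rule L)

text \<open>The new step function depends only on the old one, so the union in
  \<open>realization_map\<close> is a union of copies of one class. The second claim says that this
  step function is realized, which \<open>step_of\<close> needs in order to read it off.\<close>

lemma realization_map_point:
  assumes \<Phi>: "thin_functor K L \<Phi>" and p: "p \<in> topspace (cell_space K)"
  shows "realization_map L \<Phi> (point K (step_fun p)) =
      point L (mix (on_ob \<Phi>) (on_ob \<Phi>) 0 (step_fun p))"
    "\<exists>q\<in>topspace (cell_space L). step_fun q = mix (on_ob \<Phi>) (on_ob \<Phi>) 0 (step_fun p)"
proof -
  let ?w = "mix (on_ob \<Phi>) (on_ob \<Phi>) 0 (step_fun p)"
  let ?F = "\<lambda>(n, \<sigma>, t). realization_class L (n, nerve_map \<Phi> n \<sigma>, t)"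
  have *: "(n, nerve_map \<Phi> n \<sigma>, t) \<in> topspace (cell_space L) \<and>
      step_fun (n, nerve_map \<Phi> n \<sigma>, t) = ?w"
    if "(n, \<sigma>, t) \<in> point K (step_fun p)" for n \<sigma> t
    using that nerve_map_in_nerve[OF L \<Phi>] step_fun_nerve_map[of \<sigma> K n t \<Phi>]
    by (auto simp: point_def mem_cell_space)
  have "?F q = point L ?w" if "q \<in> point K (step_fun p)" for q
    using * that L.realization_class_eq by (cases q) auto
  moreover have "p \<in> point K (step_fun p)" using p by (simp add: point_def)
  ultimately have "(\<Union>q\<in>point K (step_fun p). ?F q) = point L ?w" by blast
  then show "realization_map L \<Phi> (point K (step_fun p)) = point L ?w"
    unfolding realization_map_def .
  show "\<exists>q\<in>topspace (cell_space L). step_fun q = ?w"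
    using * \<open>p \<in> point K (step_fun p)\<close> by (cases p) blast
qed

lemma realization_map_eq:
  assumes "thin_functor K L \<Phi>" and "S \<in> topspace (realization K)"
  shows "realization_map L \<Phi> S = point L (mix (on_ob \<Phi>) (on_ob \<Phi>) 0 (step_of S))"
  using assms realization_map_point[of \<Phi>]
  by (auto simp: K.topspace_realization step_of_point)

lemma step_of_realization_map:
  assumes "thin_functor K L \<Phi>" and "S \<in> topspace (realization K)"
  shows "step_of (realization_map L \<Phi> S) = mix (on_ob \<Phi>) (on_ob \<Phi>) 0 (step_of S)"
proof -
  obtain p where p: "p \<in> topspace (cell_space K)" "S = point K (step_fun p)"
    using assms(2) by (auto simp: K.topspace_realization)
  show ?thesis
    using realization_map_point[OF assms(1) p(1)] unfolding p(2) step_of_point[OF p(1)]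
    by (metis step_of_point)
qed

text \<open>This is the slice at a = 0 of the homotopy with \<phi> = \<psi>.\<close>

lemma continuous_realization_map:
  assumes "thin_functor K L \<Phi>"
  shows "continuous_map (realization K) (realization L) (realization_map L \<Phi>)"
proof -
  note \<phi> = thin_functor_monotone[OF assms]
  have "continuous_map (realization K) (prod_topology (top_of_set {0..1}) (realization K))
      (\<lambda>S. (0 :: real, S))"
    by (intro continuous_map_pairedI) auto
  moreover have "reach L (on_ob \<Phi> x) (on_ob \<Phi> x)" if "x \<in> Ob K" for x
    using \<phi> that by (intro L.reach_refl) (auto simp: monotone_on_reach_def)
  note continuous_map_mix[OF K L \<phi> \<phi> this]
  ultimately have "continuous_map (realization K) (realization L)
      ((\<lambda>(a, S). point L (mix (on_ob \<Phi>) (on_ob \<Phi>) a (step_of S))) \<circ> (\<lambda>S. (0, S)))"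
    by (rule continuous_map_compose)
  then show ?thesis
    by (rule continuous_map_eq) (simp add: realization_map_eq[OF assms])
qed

lemma realization_map_in_topspace:
  assumes "thin_functor K L \<Phi>" and "S \<in> topspace (realization K)"
  shows "realization_map L \<Phi> S \<in> topspace (realization L)"
  using continuous_map_image_subset_topspace[OF continuous_realization_map[OF assms(1)]] assms(2)
  by blast

end

lemma mix_mix_right: "mix \<phi> \<phi>' a (mix \<psi> \<psi> 0 w) = mix (\<phi> \<circ> \<psi>) (\<phi>' \<circ> \<psi>) a w"
  by (auto simp: mix_def)

lemma mix_mix_left: "mix \<psi> \<psi> 0 (mix \<phi> \<phi>' a w) = mix (\<psi> \<circ> \<phi>) (\<psi> \<circ> \<phi>') a w"
  by (auto simp: mix_def)

lemma mix_cong_step_of: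
  assumes "thin_cat K" "S \<in> topspace (realization K)"
    "\<And>x. x \<in> Ob K \<Longrightarrow> \<phi> x = \<phi>' x" "\<And>x. x \<in> Ob K \<Longrightarrow> \<psi> x = \<psi>' x"
  shows "mix \<phi> \<psi> a (step_of S) = mix \<phi>' \<psi>' a (step_of S)"
  using assms(3,4) thin_cat.step_of_Ob[OF assms(1,2)] by (intro mix_cong) auto

lemma mix_id_step_of:
  assumes "thin_cat K" "S \<in> topspace (realization K)" "\<And>x. x \<in> Ob K \<Longrightarrow> \<phi> x = x"
  shows "mix \<phi> \<phi> 0 (step_of S) = step_of S"
  using assms(3) thin_cat.step_of_Ob[OF assms(1,2)] thin_cat.step_of_undefined[OF assms(1,2)]
  by (fastforce simp: mix_def restrict_def fun_eq_iff)

section \<open>Equivariant maps and homotopies between realizations\<close>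

definition thin_action ::
    "('g, 'c) monoid_scheme \<Rightarrow> ('o, 'f) small_cat \<Rightarrow> ('g \<Rightarrow> ('o, 'f, 'o, 'f) cat_functor) \<Rightarrow> bool" where
  "thin_action G K a \<longleftrightarrow> thin_cat K \<and> (\<forall>g\<in>carrier G. thin_functor K K (a g))"

text \<open>The action stays inside the space, so only values there matter. This permits the
  exchange of \<open>id\<close> for the map induced by the identity functor.\<close>

lemma G_equivariant_cong:
  assumes "thin_action G K a" "\<And>S. S \<in> topspace (realization K) \<Longrightarrow> h S = k S"
  shows "G_equivariant G (realization K) (\<lambda>g. realization_map K (a g)) b h \<longleftrightarrow>
    G_equivariant G (realization K) (\<lambda>g. realization_map K (a g)) b k"
  using assms realization_map_in_topspace[of K K "a g" for g]
  by (auto simp: G_equivariant_def thin_action_def)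

lemma G_map_realization_map:
  assumes K: "thin_action G K a" and L: "thin_action G L b" and \<Phi>: "thin_functor K L \<Phi>"
    and eq: "\<And>g x. g \<in> carrier G \<Longrightarrow> x \<in> Ob K \<Longrightarrow>
      on_ob \<Phi> (on_ob (a g) x) = on_ob (b g) (on_ob \<Phi> x)"
  shows "G_map G (realization K) (\<lambda>g. realization_map K (a g))
    (realization L) (\<lambda>g. realization_map L (b g)) (realization_map L \<Phi>)"
  unfolding G_map_def G_equivariant_def
proof (intro conjI ballI)
  have KL: "thin_cat K" "thin_cat L" using K L by (auto simp: thin_action_def)
  then show "continuous_map (realization K) (realization L) (realization_map L \<Phi>)"
    using \<Phi> by (rule continuous_realization_map)
  fix g S assume g: "g \<in> carrier G" and S: "S \<in> topspace (realization K)"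
  have ag: "thin_functor K K (a g)" and bg: "thin_functor L L (b g)"
    using K L g by (auto simp: thin_action_def)
  note agS = realization_map_in_topspace[OF KL(1,1) ag S]
  note PS = realization_map_in_topspace[OF KL \<Phi> S]
  show "realization_map L \<Phi> (realization_map K (a g) S) =
      realization_map L (b g) (realization_map L \<Phi> S)"
    unfolding realization_map_eq[OF KL \<Phi> agS] realization_map_eq[OF KL(2,2) bg PS]
      step_of_realization_map[OF KL(1,1) ag S] step_of_realization_map[OF KL \<Phi> S] mix_mix_left mix_mix_right
    by (intro arg_cong[where f = "point L"] mix_cong_step_of[OF KL(1) S]) (auto simp: eq g)
qed

text \<open>Cutting commutes with composition on either side, by \<open>mix_mix_left\<close> and
  \<open>mix_mix_right\<close>, so each stage is equivariant because both functors are. At time 0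
  the cut leaves \<Psi>; hence the homotopy runs against the direction of the arrows.\<close>

lemma G_homotopic_realization_map:
  assumes K: "thin_action G K a" and L: "thin_action G L b"
    and \<Phi>: "thin_functor K L \<Phi>" and \<Psi>: "thin_functor K L \<Psi>"
    and eq: "\<And>g x. g \<in> carrier G \<Longrightarrow> x \<in> Ob K \<Longrightarrow>
      on_ob \<Phi> (on_ob (a g) x) = on_ob (b g) (on_ob \<Phi> x)"
      "\<And>g x. g \<in> carrier G \<Longrightarrow> x \<in> Ob K \<Longrightarrow>
      on_ob \<Psi> (on_ob (a g) x) = on_ob (b g) (on_ob \<Psi> x)"
    and le: "\<And>x. x \<in> Ob K \<Longrightarrow> reach L (on_ob \<Phi> x) (on_ob \<Psi> x)"
  shows "G_homotopic G (realization K) (\<lambda>g. realization_map K (a g))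
    (realization L) (\<lambda>g. realization_map L (b g)) (realization_map L \<Psi>) (realization_map L \<Phi>)"
proof -
  have KL: "thin_cat K" "thin_cat L" using K L by (auto simp: thin_action_def)
  let ?p = "\<lambda>r S. point L (mix (on_ob \<Phi>) (on_ob \<Psi>) r (step_of S))"
  let ?h = "\<lambda>(r, S). ?p r S"
  note cont = continuous_map_mix[OF KL thin_functor_monotone[OF \<Phi>] thin_functor_monotone[OF \<Psi>] le]
  have step: "step_of (?p r S) = mix (on_ob \<Phi>) (on_ob \<Psi>) r (step_of S)"
    and top: "?p r S \<in> topspace (realization L)"
    if S: "S \<in> topspace (realization K)" and r: "r \<in> {0..1}" for r S
  proof -
    \<comment> \<open>Continuity includes mapping into the space, and so yields that the cut step
      function is realized.\<close>
    show top: "?p r S \<in> topspace (realization L)"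
      using continuous_map_image_subset_topspace[OF cont] S r by fastforce
    obtain q where q: "q \<in> topspace (cell_space L)" "?p r S = point L (step_fun q)"
      using top by (auto simp: thin_cat.topspace_realization[OF KL(2)])
    then have "q \<in> ?p r S" by (simp add: point_def)
    then have w: "step_fun q = mix (on_ob \<Phi>) (on_ob \<Psi>) r (step_of S)" by (simp add: point_def)
    show "step_of (?p r S) = mix (on_ob \<Phi>) (on_ob \<Psi>) r (step_of S)"
      using step_of_point[OF q(1)] unfolding w .
  qed
  have equi: "G_equivariant G (realization K) (\<lambda>g. realization_map K (a g))
      (\<lambda>g. realization_map L (b g)) (?p r)" if r: "r \<in> {0..1}" for r
    unfolding G_equivariant_def
  proof (intro ballI)
    fix g S assume g: "g \<in> carrier G" and S: "S \<in> topspace (realization K)"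
    have ag: "thin_functor K K (a g)" and bg: "thin_functor L L (b g)"
      using K L g by (auto simp: thin_action_def)
    note agS = realization_map_in_topspace[OF KL(1,1) ag S]
    show "?p r (realization_map K (a g) S) = realization_map L (b g) (?p r S)"
      unfolding realization_map_eq[OF KL(2,2) bg top[OF S r]] step[OF S r]
        step_of_realization_map[OF KL(1,1) ag S] mix_mix_left mix_mix_right
      by (intro arg_cong[where f = "point L"] mix_cong_step_of[OF KL(1) S]) (auto simp: eq g)
  qed
  show ?thesis
    unfolding G_homotopic_def
  proof (subst homotopic_with, rule G_equivariant_cong[OF K], assumption, intro exI conjI)
    show "\<forall>S\<in>topspace (realization K). ?h (0, S) = realization_map L \<Psi> S"
      using realization_map_eq[OF KL \<Psi>] by (simp add: mix_0[of "on_ob \<Phi>" "on_ob \<Psi>"])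
    show "\<forall>S\<in>topspace (realization K). ?h (1, S) = realization_map L \<Phi> S"
      using realization_map_eq[OF KL \<Phi>] by (simp add: mix_1[of "on_ob \<Phi>" "on_ob \<Psi>"])
  qed (use cont equi in auto)
qed

text \<open>A map r of objects suffices for the inverse, since monotonicity supplies the arrows. The
  homotopies relate maps induced by functors; these agree on the spaces with the actual composites
  and with \<open>id\<close>. When the composites lie below the identities, the homotopies come out
  reversed and symmetry turns them round.\<close>

lemma induces_G_homotopy_equivalence_thin:
  fixes K :: "('o, 'f) small_cat" and L :: "('p, 'h) small_cat"
  assumes K: "thin_action G K a" and L: "thin_action G L b" and \<Phi>: "thin_functor K L \<Phi>"
    and eq: "\<And>g x. g \<in> carrier G \<Longrightarrow> x \<in> Ob K \<Longrightarrow>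
      on_ob \<Phi> (on_ob (a g) x) = on_ob (b g) (on_ob \<Phi> x)"
    and r: "monotone_on_reach L K r"
    and r_eq: "\<And>g x. g \<in> carrier G \<Longrightarrow> x \<in> Ob L \<Longrightarrow> r (on_ob (b g) x) = on_ob (a g) (r x)"
    and comparable:
      "(\<forall>x\<in>Ob K. reach K x (r (on_ob \<Phi> x))) \<and> (\<forall>y\<in>Ob L. reach L y (on_ob \<Phi> (r y))) \<or>
       (\<forall>x\<in>Ob K. reach K (r (on_ob \<Phi> x)) x) \<and> (\<forall>y\<in>Ob L. reach L (on_ob \<Phi> (r y)) y)"
  shows "induces_G_homotopy_equivalence G K a L b \<Phi>"
proof -
  have KL: "thin_cat K" "thin_cat L" using K L by (auto simp: thin_action_def)
  obtain R where R: "thin_functor L K R" and R_ob: "on_ob R = r"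
    by (rule thin_functor_of_monotone[OF r])
  have \<Phi>_ob: "on_ob \<Phi> x \<in> Ob L" if "x \<in> Ob K" for x
    using \<Phi> that by (auto simp: thin_functor_def)
  have R_Ob: "r x \<in> Ob K" if "x \<in> Ob L" for x
    using r that by (auto simp: monotone_on_reach_def)
  define I :: "('o, 'f, 'o, 'f) cat_functor" where "I = inclusion_functor"
  define J :: "('p, 'h, 'p, 'h) cat_functor" where "J = inclusion_functor"
  have I: "thin_functor K K I" "on_ob I = (\<lambda>x. x)" and J: "thin_functor L L J" "on_ob J = (\<lambda>x. x)"
    by (auto simp: thin_functor_def I_def J_def inclusion_functor_def)
  have "monotone_on_reach K K (r \<circ> on_ob \<Phi>)" "monotone_on_reach L L (on_ob \<Phi> \<circ> r)"
    using r thin_functor_monotone[OF \<Phi>] by (auto simp: monotone_on_reach_def Pi_iff)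
  then obtain R\<Phi> \<Phi>R where R\<Phi>: "thin_functor K K R\<Phi>" "on_ob R\<Phi> = r \<circ> on_ob \<Phi>"
    and \<Phi>R: "thin_functor L L \<Phi>R" "on_ob \<Phi>R = on_ob \<Phi> \<circ> r"
    using thin_functor_of_monotone by metis
  let ?aK = "\<lambda>g. realization_map K (a g)" and ?bL = "\<lambda>g. realization_map L (b g)"
  have I_id: "id S = realization_map K I S" if S: "S \<in> topspace (realization K)" for S
    using realization_map_eq[OF KL(1,1) I(1) S] mix_id_step_of[OF KL(1) S]
      thin_cat.point_step_of[OF KL(1) S] by (simp add: I(2))
  have J_id: "id S = realization_map L J S" if S: "S \<in> topspace (realization L)" for S
    using realization_map_eq[OF KL(2,2) J(1) S] mix_id_step_of[OF KL(2) S]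
      thin_cat.point_step_of[OF KL(2) S] by (simp add: J(2))
  have R\<Phi>_comp: "(realization_map K R \<circ> realization_map L \<Phi>) S = realization_map K R\<Phi> S"
    if S: "S \<in> topspace (realization K)" for S
    using realization_map_eq[OF KL(1,1) R\<Phi>(1) S] step_of_realization_map[OF KL \<Phi> S]
      realization_map_eq[OF KL(2,1) R realization_map_in_topspace[OF KL \<Phi> S]]
    by (simp add: R\<Phi>(2) mix_mix_right R_ob)
  have \<Phi>R_comp: "(realization_map L \<Phi> \<circ> realization_map K R) S = realization_map L \<Phi>R S"
    if S: "S \<in> topspace (realization L)" for S
    using realization_map_eq[OF KL(2,2) \<Phi>R(1) S] step_of_realization_map[OF KL(2,1) R S]
      realization_map_eq[OF KL \<Phi> realization_map_in_topspace[OF KL(2,1) R S]]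
    by (simp add: \<Phi>R(2) mix_mix_right R_ob)
  have "G_homotopic G (realization K) ?aK (realization K) ?aK (realization_map K R\<Phi>) (realization_map K I) \<and>
     G_homotopic G (realization L) ?bL (realization L) ?bL (realization_map L \<Phi>R) (realization_map L J)"
    using comparable
  proof
    assume *: "(\<forall>x\<in>Ob K. reach K x (r (on_ob \<Phi> x))) \<and> (\<forall>y\<in>Ob L. reach L y (on_ob \<Phi> (r y)))"
    show ?thesis
      by (intro conjI G_homotopic_realization_map K L I J R\<Phi> \<Phi>R)
        (use * in \<open>auto simp: I J R\<Phi> \<Phi>R eq r_eq \<Phi>_ob R_Ob\<close>)
  next
    assume *: "(\<forall>x\<in>Ob K. reach K (r (on_ob \<Phi> x)) x) \<and> (\<forall>y\<in>Ob L. reach L (on_ob \<Phi> (r y)) y)"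
    have "G_homotopic G (realization K) ?aK (realization K) ?aK (realization_map K I) (realization_map K R\<Phi>) \<and>
     G_homotopic G (realization L) ?bL (realization L) ?bL (realization_map L J) (realization_map L \<Phi>R)"
      by (intro conjI G_homotopic_realization_map K L I J R\<Phi> \<Phi>R)
        (use * in \<open>auto simp: I J R\<Phi> \<Phi>R eq r_eq \<Phi>_ob R_Ob\<close>)
    then show ?thesis by (simp add: G_homotopic_def homotopic_with_sym)
  qed
  then have 1: "homotopic_with (G_equivariant G (realization K) ?aK ?aK) (realization K) (realization K)
        (realization_map K R\<Phi>) (realization_map K I)"
    and 2: "homotopic_with (G_equivariant G (realization L) ?bL ?bL) (realization L) (realization L)
        (realization_map L \<Phi>R) (realization_map L J)"
    by (simp_all add: G_homotopic_def)
  have "G_homotopic G (realization K) ?aK (realization K) ?aK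
      (realization_map K R \<circ> realization_map L \<Phi>) id"
    unfolding G_homotopic_def
    by (rule homotopic_with_eq[OF 1 R\<Phi>_comp I_id G_equivariant_cong[OF K]])
  moreover have "G_homotopic G (realization L) ?bL (realization L) ?bL
      (realization_map L \<Phi> \<circ> realization_map K R) id"
    unfolding G_homotopic_def
    by (rule homotopic_with_eq[OF 2 \<Phi>R_comp J_id G_equivariant_cong[OF L]])
  moreover have "G_map G (realization K) ?aK (realization L) ?bL (realization_map L \<Phi>)"
    by (rule G_map_realization_map[OF K L \<Phi> eq])
  moreover have "G_map G (realization L) ?bL (realization K) ?aK (realization_map K R)"
    by (rule G_map_realization_map[OF L K R]) (simp add: R_ob r_eq)
  ultimately show ?thesis
    unfolding induces_G_homotopy_equivalence_def G_homotopy_equivalence_def by blast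
qed


section \<open>Collections of subgroups\<close>

lemma conjugate_eq: "conjugate G g P = (\<lambda>p. g \<otimes>\<^bsub>G\<^esub> p \<otimes>\<^bsub>G\<^esub> inv\<^bsub>G\<^esub> g) ` P"
  by (auto simp: conjugate_def l_coset_def r_coset_def)

lemma conjugate_mono: "P \<subseteq> Q \<Longrightarrow> conjugate G g P \<subseteq> conjugate G g Q"
  by (auto simp: conjugate_eq)

lemma centralizer_antimono: "P \<subseteq> Q \<Longrightarrow> centralizer G Q \<subseteq> centralizer G P"
  by (auto simp: centralizer_def)

definition EA_image :: "'g EA_ob \<Rightarrow> 'g set" where
  "EA_image = (\<lambda>(H, i). i ` H)"

lemma (in group) inv_mult_cancel: "\<lbrakk>x \<in> carrier G; y \<in> carrier G\<rbrakk> \<Longrightarrow> inv x \<otimes> (x \<otimes> y) = y"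
  and mult_inv_cancel: "\<lbrakk>x \<in> carrier G; y \<in> carrier G\<rbrakk> \<Longrightarrow> x \<otimes> (inv x \<otimes> y) = y"
  by (simp_all flip: m_assoc)

locale group_collection = group G for G :: "('g, 'c) monoid_scheme" (structure) +
  fixes C :: "'g set set"
  assumes coll: "collection G C"
begin

lemma C_subgroup: "P \<in> C \<Longrightarrow> subgroup P G"
  using coll by (simp add: collection_def)

lemma C_conjugate: "P \<in> C \<Longrightarrow> g \<in> carrier G \<Longrightarrow> conjugate G g P \<in> C"
  using coll by (simp add: collection_def)

lemma thin_cat_poset: "thin_cat (poset_cat C)"
  by unfold_locales (auto simp: poset_cat_def split: if_splits)

lemma thin_action_poset: "thin_action G (poset_cat C) (poset_action G)"
  unfolding thin_action_def thin_functor_def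
  using thin_cat_poset C_conjugate conjugate_mono by (force simp: poset_cat_def poset_action_def)


section \<open>The category EO\<close>

lemma lcosetsE:
  assumes "x \<in> lcosets H"
  obtains a where "a \<in> carrier G" "x = a <# H"
  using assms by (auto simp: LCOSETS_def)

lemma lcosets_translate:
  assumes "subgroup H G" "x \<in> lcosets H" "g \<in> carrier G"
  shows "g <# x \<in> lcosets H"
proof -
  obtain a where "a \<in> carrier G" "x = a <# H" using assms(2) by (rule lcosetsE)
  then show ?thesis
    using assms by (auto simp: LCOSETS_def lcos_m_assoc subgroup.subset)
qed

lemma EO_ObE:
  assumes "X \<in> Ob (EO G C)"
  obtains H a where "H \<in> C" "subgroup H G" "a \<in> carrier G" "X = (lcosets H, a <# H)"
  using assms C_subgroup by (auto simp: EO_def LCOSETS_def)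

lemma EO_ObI: "H \<in> C \<Longrightarrow> a \<in> carrier G \<Longrightarrow> (lcosets H, a <# H) \<in> Ob (EO G C)"
  by (auto simp: EO_def LCOSETS_def)

lemma EO_Hom_iff:
  "f \<in> Hom (EO G C) (X, x) (Y, y) \<longleftrightarrow> f \<in> X \<rightarrow>\<^sub>E Y \<and>
    (\<forall>g\<in>carrier G. \<forall>z\<in>X. f (g <# z) = g <# f z) \<and> f x = y"
  by (simp add: EO_def)

lemma lcosets_transitive:
  assumes "subgroup H G" "x \<in> lcosets H" "z \<in> lcosets H"
  obtains g where "g \<in> carrier G" "z = g <# x"
proof -
  obtain a b where ab: "a \<in> carrier G" "x = a <# H" "b \<in> carrier G" "z = b <# H"
    using assms(2,3) by (metis lcosetsE)
  then have "z = (b \<otimes> inv a) <# x"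
    using assms(1) by (simp add: lcos_m_assoc subgroup.subset m_assoc)
  then show ?thesis using ab that by blast
qed

text \<open>G acts transitively on G/H, so a G-map is determined by its value at one point, and an
  arrow prescribes such a value.\<close>

lemma thin_cat_EO: "thin_cat (EO G C)"
proof
  fix X assume "X \<in> Ob (EO G C)"
  then obtain H a where X: "subgroup H G" "a \<in> carrier G" "X = (lcosets H, a <# H)"
    by (rule EO_ObE)
  moreover have "a <# H \<in> lcosets H" using X by (auto simp: LCOSETS_def)
  ultimately show "Ident (EO G C) X \<in> Hom (EO G C) X X"
    by (auto simp: EO_def lcosets_translate)
next
  fix X Y Z f g
  assume ob: "X \<in> Ob (EO G C)" "Y \<in> Ob (EO G C)" "Z \<in> Ob (EO G C)"
    and f: "f \<in> Hom (EO G C) X Y" and g: "g \<in> Hom (EO G C) Y Z"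
  obtain H a where X: "subgroup H G" "a \<in> carrier G" "X = (lcosets H, a <# H)"
    using ob(1) by (rule EO_ObE)
  obtain U u V v where Y: "Y = (U, u)" and Z: "Z = (V, v)" by (meson surj_pair)
  have "a <# H \<in> lcosets H" using X by (auto simp: LCOSETS_def)
  then show "Comp (EO G C) X Y Z g f \<in> Hom (EO G C) X Z"
    using f g lcosets_translate[OF X(1)] unfolding X(3) Y Z EO_Hom_iff
    by (auto simp: EO_def compose_def PiE_def Pi_def)
next
  fix X Y f f'
  assume ob: "X \<in> Ob (EO G C)"
    and f: "f \<in> Hom (EO G C) X Y" "f' \<in> Hom (EO G C) X Y"
  obtain H a where X: "subgroup H G" "a \<in> carrier G" "X = (lcosets H, a <# H)"
    using ob(1) by (rule EO_ObE)
  obtain U u where Y: "Y = (U, u)" by (cases Y)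
  have x: "a <# H \<in> lcosets H" using X by (auto simp: LCOSETS_def)
  note f = f[unfolded X(3) Y EO_Hom_iff]
  show "f = f'"
  proof (rule extensionalityI)
    show "f \<in> extensional (lcosets H)" "f' \<in> extensional (lcosets H)"
      using f by (auto simp: PiE_def)
    fix z assume "z \<in> lcosets H"
    then obtain g where "g \<in> carrier G" "z = g <# (a <# H)"
      using lcosets_transitive[OF X(1) x] by blast
    then show "f z = f' z" using f x by auto
  qed
qed

lemma thin_action_EO: "thin_action G (EO G C) (EO_action G)"
  unfolding thin_action_def
proof (intro conjI ballI thin_cat_EO)
  fix g assume g: "g \<in> carrier G"
  show "thin_functor (EO G C) (EO G C) (EO_action G g)"
    unfolding thin_functor_def
  proof (intro conjI funcsetI ballI)
    fix X assume "X \<in> Ob (EO G C)"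
    then obtain H a where "H \<in> C" "subgroup H G" "a \<in> carrier G" "X = (lcosets H, a <# H)"
      by (rule EO_ObE)
    then show "on_ob (EO_action G g) X \<in> Ob (EO G C)"
      using g by (auto simp: EO_action_def lcos_m_assoc subgroup.subset intro!: EO_ObI)
  next
    fix X Y f assume X: "X \<in> Ob (EO G C)" and f: "f \<in> Hom (EO G C) X Y"
    obtain H a where H: "subgroup H G" "a \<in> carrier G" "X = (lcosets H, a <# H)"
      using X by (rule EO_ObE)
    have "a <# H \<in> lcosets H" using H by (auto simp: LCOSETS_def)
    moreover obtain U u where "Y = (U, u)" by (cases Y)
    ultimately show "on_arr (EO_action G g) X Y f
        \<in> Hom (EO G C) (on_ob (EO_action G g) X) (on_ob (EO_action G g) Y)"
      using f g by (auto simp: EO_action_def H EO_Hom_iff)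
  qed
qed

text \<open>The conjugate aHa^-1 is the isotropy group of the point aH. An equivariant map can only
  enlarge isotropy; conversely, the inclusion makes gaH \<mapsto> gbK well defined.\<close>

lemma reach_EO_iff:
  assumes H: "subgroup H G" and K: "subgroup K G" and a: "a \<in> carrier G" and b: "b \<in> carrier G"
  shows "reach (EO G C) (lcosets H, a <# H) (lcosets K, b <# K) \<longleftrightarrow>
    conjugate G a H \<subseteq> conjugate G b K"
proof
  note Hc = subgroup.mem_carrier[OF H] and Kc = subgroup.mem_carrier[OF K]
  assume "reach (EO G C) (lcosets H, a <# H) (lcosets K, b <# K)"
  then obtain f where "f \<in> Hom (EO G C) (lcosets H, a <# H) (lcosets K, b <# K)"
    by (auto simp: reach_def)
  then have f: "\<And>g z. g \<in> carrier G \<Longrightarrow> z \<in> lcosets H \<Longrightarrow> f (g <# z) = g <# f z"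
    "f (a <# H) = b <# K"
    by (auto simp: EO_Hom_iff)
  have x: "a <# H \<in> lcosets H" using a by (auto simp: LCOSETS_def)
  show "conjugate G a H \<subseteq> conjugate G b K"
  proof
    fix y assume "y \<in> conjugate G a H"
    then obtain h where h: "h \<in> H" "y = a \<otimes> h \<otimes> inv a" by (auto simp: conjugate_eq)
    have y: "y \<in> carrier G" using h a Hc by simp
    have "y <# (a <# H) = (y \<otimes> a) <# H"
      using y a H by (simp add: lcos_m_assoc subgroup.subset)
    also have "y \<otimes> a = a \<otimes> h" using h a Hc by (simp add: m_assoc)
    also have "(a \<otimes> h) <# H = a <# (h <# H)"
      using a h Hc H by (simp add: lcos_m_assoc subgroup.subset)
    also have "h <# H = H" using coset_join3[OF _ H] h Hc by simp
    finally have "y <# (b <# K) = b <# K"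
      using f(1)[OF y x] f(2) by simp
    moreover have "y \<otimes> b \<in> y <# (b <# K)"
      using b subgroup.one_closed[OF K] by (force simp: l_coset_def)
    ultimately obtain k where k: "k \<in> K" "y \<otimes> b = b \<otimes> k" by (auto simp: l_coset_def)
    then have "y = b \<otimes> k \<otimes> inv b" using y b Kc by (metis inv_solve_right m_closed)
    then show "y \<in> conjugate G b K" using k by (auto simp: conjugate_eq)
  qed
next
  note Hc = subgroup.mem_carrier[OF H] and Kc = subgroup.mem_carrier[OF K]
  assume sub: "conjugate G a H \<subseteq> conjugate G b K"
  \<comment> \<open>Right multiplication of sets by the coset of \<open>inv a \<otimes> b\<close>
    expresses gaH \<mapsto> gbK without choosing representatives.\<close>
  define f where "f = (\<lambda>z\<in>lcosets H. z <#> ((inv a \<otimes> b) <# K))"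
  have f_eq: "(c \<otimes> a <# H) <#> ((inv a \<otimes> b) <# K) = (c \<otimes> b) <# K" (is "?l = ?r")
    if c: "c \<in> carrier G" for c
  proof
    show "?l \<subseteq> ?r"
    proof
      fix y assume "y \<in> ?l"
      then obtain h k where hk: "h \<in> H" "k \<in> K" "y = (c \<otimes> a \<otimes> h) \<otimes> (inv a \<otimes> b \<otimes> k)"
        by (auto simp: set_mult_def l_coset_def)
      \<comment> \<open>Bracketing out this conjugate of h lets the hypothesis absorb h into
        K.\<close>
      have "a \<otimes> h \<otimes> inv a \<in> conjugate G b K"
        using sub hk(1) by (auto simp: conjugate_eq)
      then obtain k' where k': "k' \<in> K" "a \<otimes> h \<otimes> inv a = b \<otimes> k' \<otimes> inv b"
        by (auto simp: conjugate_eq)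
      have "y = c \<otimes> (a \<otimes> h \<otimes> inv a) \<otimes> b \<otimes> k"
        using hk a b c Hc Kc by (simp add: m_assoc)
      also have "\<dots> = c \<otimes> b \<otimes> (k' \<otimes> k)"
        unfolding k'(2) using k'(1) hk(2) b c Kc by (simp add: m_assoc inv_mult_cancel mult_inv_cancel)
      finally show "y \<in> ?r"
        using subgroup.m_closed[OF K k'(1) hk(2)] by (auto simp: l_coset_def)
    qed
    show "?r \<subseteq> ?l"
    proof
      fix y assume "y \<in> ?r"
      then obtain k where k: "k \<in> K" "y = c \<otimes> b \<otimes> k" by (auto simp: l_coset_def)
      then have "y = (c \<otimes> a \<otimes> \<one>) \<otimes> (inv a \<otimes> b \<otimes> k)"
        using a b c Kc by (simp add: m_assoc inv_mult_cancel mult_inv_cancel)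
      then show "y \<in> ?l"
        using subgroup.one_closed[OF H] k(1) unfolding set_mult_def l_coset_def by blast
    qed
  qed
  have z_eq: "\<exists>c\<in>carrier G. z = c \<otimes> a <# H" if z: "z \<in> lcosets H" for z
  proof -
    obtain d where "d \<in> carrier G" "z = d <# H" using z by (rule lcosetsE)
    then show ?thesis using a by (intro bexI[of _ "d \<otimes> inv a"]) (auto simp: m_assoc)
  qed
  have "f \<in> Hom (EO G C) (lcosets H, a <# H) (lcosets K, b <# K)"
    unfolding EO_Hom_iff
  proof (intro conjI ballI)
    show "f \<in> lcosets H \<rightarrow>\<^sub>E lcosets K"
    proof (rule PiE_I)
      fix z assume z: "z \<in> lcosets H"
      then obtain c where c: "c \<in> carrier G" "z = c \<otimes> a <# H" using z_eq by blast
      then show "f z \<in> lcosets K"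
        using z b f_eq[OF c(1)] by (auto simp: f_def LCOSETS_def)
    qed (simp add: f_def)
    show "f (a <# H) = b <# K"
      using a b f_eq[of \<one>] by (auto simp: f_def LCOSETS_def)
    fix g z assume g: "g \<in> carrier G" and z: "z \<in> lcosets H"
    obtain c where c: "c \<in> carrier G" "z = c \<otimes> a <# H" using z_eq z by blast
    have gz: "g <# z = (g \<otimes> c) \<otimes> a <# H"
      using c g a H by (simp add: lcos_m_assoc subgroup.subset m_assoc)
    have "f (g <# z) = ((g \<otimes> c) \<otimes> b) <# K"
      using lcosets_translate[OF H z g] f_eq[of "g \<otimes> c"] g c(1) unfolding gz
      by (simp add: f_def)
    also have "\<dots> = g <# ((c \<otimes> b) <# K)"
      using c g b K by (simp add: lcos_m_assoc subgroup.subset m_assoc)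
    also have "(c \<otimes> b) <# K = f z"
      using z f_eq[OF c(1)] by (simp add: f_def c(2))
    finally show "f (g <# z) = g <# f z" .
  qed
  then show "reach (EO G C) (lcosets H, a <# H) (lcosets K, b <# K)"
    by (auto simp: reach_def)
qed


section \<open>The category EA\<close>

lemma EA_Ob_iff:
  "(H, i) \<in> Ob (EA G C) \<longleftrightarrow> H \<in> C \<and> i \<in> extensional H \<and> i ` H \<in> C \<and> i ` H \<subseteq> carrier G \<and>
     inj_on i H \<and> (\<forall>x\<in>H. \<forall>y\<in>H. i (x \<otimes> y) = i x \<otimes> i y)"
  by (auto simp: EA_def mon_def hom_def)

lemma EA_Hom_iff:
  "\<phi> \<in> Hom (EA G C) (H, i) (K, j) \<longleftrightarrow> \<phi> \<in> H \<rightarrow>\<^sub>E K \<and>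
     (\<forall>x\<in>H. \<forall>y\<in>H. \<phi> (x \<otimes> y) = \<phi> x \<otimes> \<phi> y) \<and> i = compose H j \<phi>"
  by (auto simp: EA_def hom_def PiE_def)

lemma EA_Hom_apply:
  "\<phi> \<in> Hom (EA G C) (H, i) (K, j) \<Longrightarrow> h \<in> H \<Longrightarrow> \<phi> h \<in> K \<and> i h = j (\<phi> h)"
  unfolding EA_Hom_iff by (auto simp: compose_def)

text \<open>In i = j \<phi> the map j is injective, so i and j determine \<phi>.\<close>

lemma thin_cat_EA: "thin_cat (EA G C)"
proof
  fix X assume "X \<in> Ob (EA G C)"
  moreover obtain H i where X: "X = (H, i)" by (cases X)
  ultimately have H: "H \<in> C" and i: "i \<in> extensional H" by (auto simp: EA_Ob_iff)
  then show "Ident (EA G C) X \<in> Hom (EA G C) X X"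
    using C_subgroup[OF H] unfolding X EA_Hom_iff
    by (auto simp: EA_def subgroup.m_closed compose_def extensional_def fun_eq_iff)
next
  fix X Y Z f g
  assume ob: "X \<in> Ob (EA G C)"
    and f: "f \<in> Hom (EA G C) X Y" and g: "g \<in> Hom (EA G C) Y Z"
  obtain H i K j L l where XYZ: "X = (H, i)" "Y = (K, j)" "Z = (L, l)" by (meson surj_pair)
  have "subgroup H G" using ob C_subgroup by (auto simp: XYZ EA_Ob_iff)
  then show "Comp (EA G C) X Y Z g f \<in> Hom (EA G C) X Z"
    using f g unfolding XYZ EA_Hom_iff
    by (auto simp: EA_def compose_def PiE_def Pi_def subgroup.m_closed fun_eq_iff)
next
  fix X Y f f'
  assume ob: "X \<in> Ob (EA G C)" "Y \<in> Ob (EA G C)"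
    and f: "f \<in> Hom (EA G C) X Y" "f' \<in> Hom (EA G C) X Y"
  obtain H i K j where XY: "X = (H, i)" "Y = (K, j)" by (meson surj_pair)
  have j: "inj_on j K" using ob(2) by (auto simp: XY EA_Ob_iff)
  show "f = f'"
  proof (rule extensionalityI)
    show "f \<in> extensional H" "f' \<in> extensional H"
      using f unfolding XY EA_Hom_iff by (auto simp: PiE_def)
    fix h assume "h \<in> H"
    then show "f h = f' h"
      using EA_Hom_apply f j unfolding XY by (metis inj_onD)
  qed
qed

lemma on_ob_EA_action: "on_ob (EA_action G g) (H, i) = (H, \<lambda>h\<in>H. g \<otimes> i h \<otimes> inv g)"
  by (simp add: EA_action_def)

lemma EA_image_action: "EA_image (on_ob (EA_action G g) X) = conjugate G g (EA_image X)"
  by (cases X) (auto simp: EA_image_def on_ob_EA_action conjugate_eq)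

lemma EA_image_in_C: "X \<in> Ob (EA G C) \<Longrightarrow> EA_image X \<in> C"
  by (cases X) (auto simp: EA_image_def EA_Ob_iff)

lemma conj_mult:
  assumes "g \<in> carrier G" "x \<in> carrier G" "y \<in> carrier G"
  shows "g \<otimes> (x \<otimes> y) \<otimes> inv g = (g \<otimes> x \<otimes> inv g) \<otimes> (g \<otimes> y \<otimes> inv g)"
  using assms by (simp add: m_assoc inv_mult_cancel mult_inv_cancel)

lemma EA_action_closed:
  assumes g: "g \<in> carrier G" and X: "X \<in> Ob (EA G C)"
  shows "on_ob (EA_action G g) X \<in> Ob (EA G C)"
proof -
  obtain H i where X_eq: "X = (H, i)" by (cases X)
  note X = X[unfolded X_eq EA_Ob_iff]
  then have H: "subgroup H G" using C_subgroup by blast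
  have i: "i h \<in> carrier G" if "h \<in> H" for h using X that by auto
  have "inj_on (\<lambda>h\<in>H. g \<otimes> i h \<otimes> inv g) H"
    using X i g by (auto simp: inj_on_def)
  moreover have "(\<lambda>h\<in>H. g \<otimes> i h \<otimes> inv g) ` H = conjugate G g (i ` H)"
    by (auto simp: conjugate_eq)
  moreover have "conjugate G g (i ` H) \<in> C" using X C_conjugate g by blast
  ultimately show ?thesis
    using X i g subgroup.m_closed[OF H] C_subgroup[THEN subgroup.subset]
    unfolding X_eq on_ob_EA_action EA_Ob_iff
    by (simp add: conj_mult)
qed

lemma EA_action_one: "X \<in> Ob (EA G C) \<Longrightarrow> on_ob (EA_action G \<one>) X = X"
  by (cases X) (auto simp: on_ob_EA_action EA_Ob_iff extensional_def fun_eq_iff image_subset_iff)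

lemma EA_action_mult:
  assumes "g \<in> carrier G" "h \<in> carrier G" "X \<in> Ob (EA G C)"
  shows "on_ob (EA_action G (g \<otimes> h)) X = on_ob (EA_action G g) (on_ob (EA_action G h) X)"
  using assms
  by (cases X) (auto simp: on_ob_EA_action EA_Ob_iff fun_eq_iff image_subset_iff m_assoc inv_mult_group)

lemma thin_action_EA: "thin_action G (EA G C) (EA_action G)"
  unfolding thin_action_def
proof (intro conjI ballI thin_cat_EA)
  fix g assume g: "g \<in> carrier G"
  show "thin_functor (EA G C) (EA G C) (EA_action G g)"
    unfolding thin_functor_def
  proof (intro conjI funcsetI ballI EA_action_closed[OF g])
    fix X Y f assume f: "f \<in> Hom (EA G C) X Y"
    obtain H i K j where XY: "X = (H, i)" "Y = (K, j)" by (meson surj_pair)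
    note f = f[unfolded XY]
    have "(\<lambda>h\<in>H. g \<otimes> i h \<otimes> inv g) = compose H (\<lambda>k\<in>K. g \<otimes> j k \<otimes> inv g) f"
      using EA_Hom_apply[OF f] by (simp add: compose_def cong: restrict_cong)
    then show "on_arr (EA_action G g) X Y f
        \<in> Hom (EA G C) (on_ob (EA_action G g) X) (on_ob (EA_action G g) Y)"
      using f unfolding XY on_ob_EA_action EA_Hom_iff by (simp add: EA_action_def)
  qed
qed

text \<open>The only candidate is j^-1 i, which exists as soon as the images are nested; injectivity
  of j also makes it multiplicative.\<close>

lemma reach_EA_iff:
  assumes "X \<in> Ob (EA G C)" "Y \<in> Ob (EA G C)"
  shows "reach (EA G C) X Y \<longleftrightarrow> EA_image X \<subseteq> EA_image Y"
proof -
  obtain H i K j where XY: "X = (H, i)" "Y = (K, j)" by (meson surj_pair)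
  show ?thesis
  proof
    assume "reach (EA G C) X Y"
    then obtain f where "f \<in> Hom (EA G C) (H, i) (K, j)" by (auto simp: reach_def XY)
    from EA_Hom_apply[OF this] show "EA_image X \<subseteq> EA_image Y"
      by (auto simp: XY EA_image_def)
  next
    assume "EA_image X \<subseteq> EA_image Y"
    then have sub: "i ` H \<subseteq> j ` K" by (simp add: XY EA_image_def)
    note X = assms(1)[unfolded XY EA_Ob_iff] and Y = assms(2)[unfolded XY EA_Ob_iff]
    then have H: "subgroup H G" and K: "subgroup K G" using C_subgroup by blast+
    define \<phi> where "\<phi> = (\<lambda>h\<in>H. inv_into K j (i h))"
    have \<phi>: "\<phi> h \<in> K" "j (\<phi> h) = i h" if "h \<in> H" for h
      using that sub by (auto simp: \<phi>_def inv_into_into f_inv_into_f image_subset_iff)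
    have mult: "\<phi> (x \<otimes> y) = \<phi> x \<otimes> \<phi> y" if "x \<in> H" "y \<in> H" for x y
    proof (rule inj_onD[of j K])
      show "j (\<phi> (x \<otimes> y)) = j (\<phi> x \<otimes> \<phi> y)"
        using that X Y \<phi> subgroup.m_closed[OF H] by simp
    qed (use that Y \<phi> subgroup.m_closed[OF H] subgroup.m_closed[OF K] in auto)
    have "i = compose H j \<phi>"
      using X \<phi>(2) by (auto simp: compose_def extensional_def fun_eq_iff)
    moreover have "\<phi> \<in> extensional H" by (simp add: \<phi>_def)
    ultimately have "\<phi> \<in> Hom (EA G C) X Y"
      using \<phi>(1) mult unfolding XY EA_Hom_iff by (auto simp: PiE_def)
    then show "reach (EA G C) X Y" by (auto simp: reach_def)
  qed
qed

end

text \<open>The values of \<beta> are kept on one representative of each orbit only. Two elements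
  carrying the representative to the same point differ by an element of its stabilizer, and this
  element fixes the value of \<beta>. The first conclusion lets equivariant properties of \<beta>
  pass to r.\<close>

lemma (in group) equivariant_map_of_orbit_representatives:
  assumes act: "\<And>g x. g \<in> carrier G \<Longrightarrow> x \<in> X \<Longrightarrow> a g x \<in> X" "\<And>x. x \<in> X \<Longrightarrow> a \<one> x = x"
      "\<And>g h x. g \<in> carrier G \<Longrightarrow> h \<in> carrier G \<Longrightarrow> x \<in> X \<Longrightarrow> a (g \<otimes> h) x = a g (a h x)"
    and act': "\<And>y. y \<in> Y \<Longrightarrow> b \<one> y = y"
      "\<And>g h y. g \<in> carrier G \<Longrightarrow> h \<in> carrier G \<Longrightarrow> y \<in> Y \<Longrightarrow> b (g \<otimes> h) y = b g (b h y)"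
    and \<beta>: "\<And>x. x \<in> X \<Longrightarrow> \<beta> x \<in> Y"
    and stab: "\<And>g x. g \<in> carrier G \<Longrightarrow> x \<in> X \<Longrightarrow> a g x = x \<Longrightarrow> b g (\<beta> x) = \<beta> x"
  obtains r where "\<And>x. x \<in> X \<Longrightarrow> \<exists>g\<in>carrier G. \<exists>y\<in>X. x = a g y \<and> r x = b g (\<beta> y)"
    "\<And>g x. g \<in> carrier G \<Longrightarrow> x \<in> X \<Longrightarrow> r (a g x) = b g (r x)"
proof
  define orb where "orb = (\<lambda>x. {a g x |g. g \<in> carrier G})"
  \<comment> \<open>Choosing from the orbit as a set makes \<open>rep\<close> constant on
    orbits.\<close>
  define rep where "rep = (\<lambda>x. SOME y. y \<in> orb x)"
  define tr where "tr = (\<lambda>x. SOME g. g \<in> carrier G \<and> x = a g (rep x))"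
  define r where "r = (\<lambda>x. b (tr x) (\<beta> (rep x)))"
  have inv_act: "a (inv g) (a g x) = x" if "g \<in> carrier G" "x \<in> X" for g x
    using that act(2) act(3)[of "inv g" g x] by simp
  have rep: "rep x \<in> orb x" if "x \<in> X" for x
  proof -
    have "x \<in> orb x" using act(2)[OF that] unfolding orb_def by (auto intro!: exI[of _ \<one>])
    then show ?thesis unfolding rep_def by (rule someI)
  qed
  have rep_X: "rep x \<in> X" if "x \<in> X" for x
    using rep[OF that] act(1) that by (auto simp: orb_def)
  have tr: "tr x \<in> carrier G \<and> x = a (tr x) (rep x)" if x: "x \<in> X" for x
  proof -
    obtain g where "g \<in> carrier G" "rep x = a g x" using rep[OF x] by (auto simp: orb_def)
    then have "inv g \<in> carrier G \<and> x = a (inv g) (rep x)" using inv_act x by simp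
    then show ?thesis unfolding tr_def by (rule someI)
  qed
  have orb_act: "orb (a g x) = orb x" if g: "g \<in> carrier G" and x: "x \<in> X" for g x
  proof
    show "orb (a g x) \<subseteq> orb x"
      using g x act(3) unfolding orb_def by (auto) (metis m_closed)
    show "orb x \<subseteq> orb (a g x)"
    proof
      fix y assume "y \<in> orb x"
      then obtain h where h: "h \<in> carrier G" "y = a h x" by (auto simp: orb_def)
      then have "y = a (h \<otimes> inv g) (a g x)"
        using g x act(1) act(3)[of h "inv g" "a g x"] inv_act by simp
      then show "y \<in> orb (a g x)" using h g unfolding orb_def by blast
    qed
  qed
  show "\<exists>g\<in>carrier G. \<exists>y\<in>X. x = a g y \<and> r x = b g (\<beta> y)" if "x \<in> X" for x
    using tr[OF that] rep_X[OF that] unfolding r_def by blast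
  show "r (a g x) = b g (r x)" if g: "g \<in> carrier G" and x: "x \<in> X" for g x
  proof -
    let ?y = "rep x" and ?s = "tr (a g x)" and ?t = "g \<otimes> tr x"
    have rep_eq: "rep (a g x) = ?y" using orb_act[OF g x] by (simp add: rep_def)
    have y: "?y \<in> X" and by': "\<beta> ?y \<in> Y" using rep_X[OF x] \<beta> by auto
    have s: "?s \<in> carrier G" "a g x = a ?s ?y"
      using tr[OF act(1)[OF g x]] rep_eq by auto
    have t: "?t \<in> carrier G" "a g x = a ?t ?y"
      using tr[OF x] g act(3)[OF g _ y, of "tr x"] by auto
    have "a (inv ?t \<otimes> ?s) ?y = ?y"
      using s t y act(3)[of "inv ?t" ?s ?y] inv_act[of ?t ?y] by simp
    then have fixed: "b (inv ?t \<otimes> ?s) (\<beta> ?y) = \<beta> ?y" using stab s t y by simp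
    have "b ?s (\<beta> ?y) = b (?t \<otimes> (inv ?t \<otimes> ?s)) (\<beta> ?y)"
      using s(1) t(1) by (simp add: inv_mult_cancel mult_inv_cancel)
    also have "\<dots> = b ?t (b (inv ?t \<otimes> ?s) (\<beta> ?y))"
      using s(1) t(1) by' by (intro act'(2)) auto
    also have "\<dots> = b g (b (tr x) (\<beta> ?y))"
      unfolding fixed using act'(2)[OF g _ by'] tr[OF x] by blast
    finally show ?thesis by (simp add: r_def rep_eq)
  qed
qed


section \<open>Equivariant endomorphisms of a collection\<close>

locale collection_endomorphism = group_collection +
  fixes F :: "'a set \<Rightarrow> 'a set"
  assumes F_closed: "F \<in> C \<rightarrow> C" and F_mono: "mono_on C F"
    and F_conjugate: "\<forall>g\<in>carrier G. \<forall>P\<in>C. F (conjugate G g P) = conjugate G g (F P)"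
begin

lemma F_in_C: "P \<in> C \<Longrightarrow> F P \<in> C"
  using F_closed by blast

text \<open>Equivariance of F makes a conjugate of a value of F again a value of F, so everything
  proved for collections is available for F(C).\<close>

sublocale image: group_collection G "F ` C"
proof
  show "collection G (F ` C)"
    using F_in_C C_subgroup C_conjugate F_conjugate[rule_format, symmetric]
    by (auto simp: collection_def)
qed

text \<open>F maps F(C) into itself and is comparable with the identity there too, in the same
  direction, so it gives both homotopies.\<close>

lemma poset_G_homotopy_equivalence:
  assumes "(\<forall>P\<in>C. P \<subseteq> F P) \<or> (\<forall>P\<in>C. F P \<subseteq> P)"
  shows "induces_G_homotopy_equivalence G
    (poset_cat (F ` C)) (poset_action G) (poset_cat C) (poset_action G) inclusion_functor"
proof (rule induces_G_homotopy_equivalence_thin[where r = F])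
  show "thin_functor (poset_cat (F ` C)) (poset_cat C) inclusion_functor"
    using F_in_C by (auto simp: thin_functor_def poset_cat_def inclusion_functor_def)
  have reach: "reach (poset_cat D) P Q \<longleftrightarrow> P \<subseteq> Q" for D P Q
    by (auto simp: reach_def poset_cat_def)
  show "monotone_on_reach (poset_cat C) (poset_cat (F ` C)) F"
    using F_mono unfolding monotone_on_reach_def reach
    by (auto simp: poset_cat_def mono_on_def)
  show "(\<forall>P\<in>Ob (poset_cat (F ` C)). reach (poset_cat (F ` C)) P (F (on_ob inclusion_functor P))) \<and>
      (\<forall>P\<in>Ob (poset_cat C). reach (poset_cat C) P (on_ob inclusion_functor (F P))) \<or>
      (\<forall>P\<in>Ob (poset_cat (F ` C)). reach (poset_cat (F ` C)) (F (on_ob inclusion_functor P)) P) \<and>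
      (\<forall>P\<in>Ob (poset_cat C). reach (poset_cat C) (on_ob inclusion_functor (F P)) P)"
    using assms F_in_C unfolding reach by (auto simp: poset_cat_def inclusion_functor_def)
qed (use thin_action_poset image.thin_action_poset F_conjugate in
    \<open>auto simp: inclusion_functor_def poset_action_def poset_cat_def\<close>)

section \<open>The inclusion of coset categories\<close>

lemma EO_Hom_image: "Hom (EO G (F ` C)) = Hom (EO G C)"
  by (simp add: EO_def)

lemma EO_Ob_image: "X \<in> Ob (EO G (F ` C)) \<Longrightarrow> X \<in> Ob (EO G C)"
  using F_in_C by (auto simp: EO_def)

text \<open>An object of EO stores the set G/H and not H itself. H is recovered as the coset
  containing the unit; the union extracts it from its singleton.\<close>

lemma coset_of_one:
  assumes "subgroup H G"
  shows "\<Union>{z \<in> lcosets H. \<one> \<in> z} = H"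
proof -
  have "z = H" if z: "z \<in> lcosets H" "\<one> \<in> z" for z
  proof -
    obtain a where a: "a \<in> carrier G" "z = a <# H" using z(1) by (rule lcosetsE)
    then show ?thesis
      using z(2) assms l_repr_independence[of \<one> a H] by (simp add: lcos_mult_one subgroup.subset)
  qed
  moreover have "H \<in> lcosets H"
    using assms by (force simp: LCOSETS_def lcos_mult_one subgroup.subset)
  ultimately have "{z \<in> lcosets H. \<one> \<in> z} = {H}"
    using subgroup.one_closed[OF assms] by blast
  then show ?thesis by simp
qed

text \<open>Applied with K = \<open>F H\<close>: as H is contained in K, the product of the set aH
  with K is the single coset aK, described without reference to a.\<close>

lemma l_coset_set_mult:
  assumes "subgroup H G" "subgroup K G" "H \<subseteq> K" "a \<in> carrier G"
  shows "(a <# H) <#> K = a <# K"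
proof
  have "a \<otimes> h \<otimes> k = a \<otimes> (h \<otimes> k)" if "h \<in> H" "k \<in> K" for h k
    using assms that by (intro m_assoc) (auto dest: subgroup.mem_carrier)
  then show "(a <# H) <#> K \<subseteq> a <# K"
    using assms(3) subgroup.m_closed[OF assms(2)] by (force simp: set_mult_def l_coset_def)
  show "a <# K \<subseteq> (a <# H) <#> K"
    using assms(4) subgroup.one_closed[OF assms(1)] by (force simp: set_mult_def l_coset_def)
qed

text \<open>In terms of isotropy groups, r replaces aHa^-1 by aF(H)a^-1, which equals F(aHa^-1).
  Monotonicity of r thus comes from that of F, and each object reaches its image because H is
  contained in F(H).\<close>

lemma EO_G_homotopy_equivalence:
  assumes le: "\<forall>P\<in>C. P \<subseteq> F P"
  shows "induces_G_homotopy_equivalence G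
    (EO G (F ` C)) (EO_action G) (EO G C) (EO_action G) inclusion_functor"
proof -
  define r where "r = (\<lambda>(X, x). let K = F (\<Union>{z \<in> X. \<one> \<in> z}) in (lcosets K, x <#> K))"
  have r: "r (lcosets H, a <# H) = (lcosets (F H), a <# F H)" if "H \<in> C" "a \<in> carrier G" for H a
    using that le F_in_C C_subgroup by (simp add: r_def Let_def coset_of_one l_coset_set_mult)
  have reach: "reach (EO G D) (lcosets H, a <# H) (lcosets K, b <# K) \<longleftrightarrow>
      conjugate G a H \<subseteq> conjugate G b K"
    if "H \<in> C" "K \<in> C" "a \<in> carrier G" "b \<in> carrier G" "D = C \<or> D = F ` C" for H K a b D
    using that reach_EO_iff[of H K a b] image.reach_EO_iff[of H K a b] C_subgroup by blast
  show ?thesis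
  proof (rule induces_G_homotopy_equivalence_thin[where r = r])
    show "thin_functor (EO G (F ` C)) (EO G C) inclusion_functor"
      using EO_Ob_image EO_Hom_image by (simp add: thin_functor_def inclusion_functor_def)
    show "monotone_on_reach (EO G C) (EO G (F ` C)) r"
      unfolding monotone_on_reach_def
    proof (intro conjI funcsetI ballI impI)
      fix X assume "X \<in> Ob (EO G C)"
      then obtain H a where "H \<in> C" "a \<in> carrier G" "X = (lcosets H, a <# H)" by (rule EO_ObE)
      then show "r X \<in> Ob (EO G (F ` C))" by (simp add: r image.EO_ObI)
    next
      fix X Y assume X: "X \<in> Ob (EO G C)" and Y: "Y \<in> Ob (EO G C)" and XY: "reach (EO G C) X Y"
      obtain H a where H: "H \<in> C" "a \<in> carrier G" "X = (lcosets H, a <# H)"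
        using X by (rule EO_ObE)
      obtain K b where K: "K \<in> C" "b \<in> carrier G" "Y = (lcosets K, b <# K)"
        using Y by (rule EO_ObE)
      have "conjugate G a H \<subseteq> conjugate G b K" using XY H K reach by simp
      then have "F (conjugate G a H) \<subseteq> F (conjugate G b K)"
        using H K C_conjugate by (intro mono_onD[OF F_mono]) auto
      then show "reach (EO G (F ` C)) (r X) (r Y)"
        using H K F_conjugate F_in_C by (simp add: r reach)
    qed
    have "reach (EO G D) X (r X)" if X: "X \<in> Ob (EO G C)" and D: "D = C \<or> D = F ` C" for X D
    proof -
      obtain H a where "H \<in> C" "a \<in> carrier G" "X = (lcosets H, a <# H)"
        using X by (rule EO_ObE)
      then show ?thesis using D F_in_C le by (simp add: r reach conjugate_mono)
    qed
    then show "(\<forall>x\<in>Ob (EO G (F ` C)). reach (EO G (F ` C)) x (r (on_ob inclusion_functor x))) \<and>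
        (\<forall>y\<in>Ob (EO G C). reach (EO G C) y (on_ob inclusion_functor (r y))) \<or>
        (\<forall>x\<in>Ob (EO G (F ` C)). reach (EO G (F ` C)) (r (on_ob inclusion_functor x)) x) \<and>
        (\<forall>y\<in>Ob (EO G C). reach (EO G C) (on_ob inclusion_functor (r y)) y)"
      using EO_Ob_image by (simp add: inclusion_functor_def)
    fix g X assume g: "g \<in> carrier G" and X: "X \<in> Ob (EO G C)"
    obtain H a where H: "H \<in> C" "a \<in> carrier G" "X = (lcosets H, a <# H)"
      using X by (rule EO_ObE)
    have translate: "on_ob (EO_action G g) (lcosets K, a <# K) = (lcosets K, (g \<otimes> a) <# K)"
      if "K \<in> C" for K
      using that g H C_subgroup by (simp add: EO_action_def lcos_m_assoc subgroup.subset)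
    show "r (on_ob (EO_action G g) X) = on_ob (EO_action G g) (r X)"
      using H g F_in_C by (simp add: translate r)
  qed (use thin_action_EO image.thin_action_EO in \<open>auto simp: inclusion_functor_def\<close>)
qed

section \<open>The inclusion of categories of monomorphisms\<close>

lemma EA_Hom_image: "Hom (EA G (F ` C)) = Hom (EA G C)"
  by (simp add: EA_def)

lemma EA_Ob_image: "X \<in> Ob (EA G (F ` C)) \<Longrightarrow> X \<in> Ob (EA G C)"
  using F_in_C by (cases X) (auto simp: EA_Ob_iff image.EA_Ob_iff)

text \<open>
  The obvious candidate, sending (H, i) to the inclusion of F (i H), is equivariant only up to
  isomorphism. It is therefore used on one representative of each G-orbit and extended
  equivariantly; the centralizer hypothesis compares the stabilizers, which are C(i H) and
  C(F (i H)).
\<close>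

lemma EA_G_homotopy_equivalence:
  assumes comparable: "(\<forall>P\<in>C. P \<subseteq> F P) \<or> (\<forall>P\<in>C. F P \<subseteq> P)"
    and cent: "\<forall>P\<in>C. centralizer G P \<subseteq> centralizer G (F P)"
  shows "induces_G_homotopy_equivalence G
    (EA G (F ` C)) (EA_action G) (EA G C) (EA_action G) inclusion_functor"
proof -
  \<comment> \<open>The action keeps the domain of a monomorphism, whereas
    \<open>F (EA_image X)\<close> is conjugated along with X. This is why \<beta> is not equivariant
    on the nose.\<close>
  define \<beta> where "\<beta> = (\<lambda>X. (F (EA_image X), \<lambda>h\<in>F (EA_image X). h))"
  have \<beta>_image: "EA_image (\<beta> X) = F (EA_image X)" for X
    by (simp add: \<beta>_def EA_image_def)
  have \<beta>: "\<beta> X \<in> Ob (EA G (F ` C))" if "X \<in> Ob (EA G C)" for X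
  proof -
    have P: "EA_image X \<in> C" using EA_image_in_C[OF that] .
    show ?thesis
      using P C_subgroup[OF F_in_C[OF P]] subgroup.subset unfolding \<beta>_def image.EA_Ob_iff
      by (auto simp: inj_on_def subgroup.m_closed)
  qed
  have stab: "on_ob (EA_action G g) (\<beta> X) = \<beta> X"
    if g: "g \<in> carrier G" and X: "X \<in> Ob (EA G C)" and fixed: "on_ob (EA_action G g) X = X" for g X
  proof -
    obtain H i where Hi: "X = (H, i)" by (cases X)
    have P: "EA_image X \<in> C" using EA_image_in_C[OF X] .
    have i: "i h \<in> carrier G" if "h \<in> H" for h
      using X that by (auto simp: Hi EA_Ob_iff)
    \<comment> \<open>As the domain H does not move, fixing (H, i) means fixing i pointwise; this
      leads to the centralizer of the image and not to its normalizer.\<close>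
    have eq: "g \<otimes> i h \<otimes> inv g = i h" if "h \<in> H" for h
      using fixed that unfolding Hi on_ob_EA_action by (metis prod.inject restrict_apply')
    have "g \<otimes> i h = i h \<otimes> g" if "h \<in> H" for h
      using eq[OF that] i[OF that] g by (metis inv_solve_right' m_closed)
    then have "g \<in> centralizer G (EA_image X)"
      using g by (auto simp: centralizer_def Hi EA_image_def)
    then have "g \<in> centralizer G (F (EA_image X))" using cent P by blast
    moreover have "F (EA_image X) \<subseteq> carrier G"
      using C_subgroup[OF F_in_C[OF P]] by (rule subgroup.subset)
    ultimately have "g \<otimes> h \<otimes> inv g = h" if "h \<in> F (EA_image X)" for h
      using that g by (force simp: centralizer_def m_assoc)
    then show ?thesis
      by (simp add: \<beta>_def on_ob_EA_action cong: restrict_cong)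
  qed
  obtain r where r: "\<And>X. X \<in> Ob (EA G C) \<Longrightarrow> \<exists>g\<in>carrier G. \<exists>Y\<in>Ob (EA G C).
        X = on_ob (EA_action G g) Y \<and> r X = on_ob (EA_action G g) (\<beta> Y)"
    and r_action: "\<And>g X. g \<in> carrier G \<Longrightarrow> X \<in> Ob (EA G C) \<Longrightarrow>
        r (on_ob (EA_action G g) X) = on_ob (EA_action G g) (r X)"
    by (rule equivariant_map_of_orbit_representatives[of "Ob (EA G C)"
          "\<lambda>g. on_ob (EA_action G g)" "Ob (EA G (F ` C))" "\<lambda>g. on_ob (EA_action G g)" \<beta>])
      (use EA_action_closed EA_action_one EA_action_mult image.EA_action_one image.EA_action_mult
        \<beta> stab in auto)
  \<comment> \<open>Whatever representatives were chosen, the image of \<open>r X\<close> is F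
    applied to the image of X. Arrows of EA are governed by images, so monotonicity and the
    comparisons with the identities reduce to properties of F.\<close>
  have r_Ob: "r X \<in> Ob (EA G (F ` C))" and r_image: "EA_image (r X) = F (EA_image X)"
    if X_Ob: "X \<in> Ob (EA G C)" for X
  proof -
    obtain g Y where g: "g \<in> carrier G" and Y: "Y \<in> Ob (EA G C)"
      and X: "X = on_ob (EA_action G g) Y" and rX: "r X = on_ob (EA_action G g) (\<beta> Y)"
      using r[OF X_Ob] by blast
    show "r X \<in> Ob (EA G (F ` C))"
      unfolding rX by (rule image.EA_action_closed[OF g \<beta>[OF Y]])
    show "EA_image (r X) = F (EA_image X)"
      unfolding rX unfolding X using F_conjugate g EA_image_in_C[OF Y]
      by (simp add: EA_image_action \<beta>_image)
  qed
  show ?thesis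
  proof (rule induces_G_homotopy_equivalence_thin[where r = r])
    show "thin_functor (EA G (F ` C)) (EA G C) inclusion_functor"
      using EA_Ob_image EA_Hom_image by (simp add: thin_functor_def inclusion_functor_def)
    show "monotone_on_reach (EA G C) (EA G (F ` C)) r"
      unfolding monotone_on_reach_def
      using r_Ob mono_onD[OF F_mono] EA_image_in_C
      by (auto simp: reach_EA_iff image.reach_EA_iff r_image)
    show "(\<forall>x\<in>Ob (EA G (F ` C)). reach (EA G (F ` C)) x (r (on_ob inclusion_functor x))) \<and>
        (\<forall>y\<in>Ob (EA G C). reach (EA G C) y (on_ob inclusion_functor (r y))) \<or>
        (\<forall>x\<in>Ob (EA G (F ` C)). reach (EA G (F ` C)) (r (on_ob inclusion_functor x)) x) \<and>
        (\<forall>y\<in>Ob (EA G C). reach (EA G C) (on_ob inclusion_functor (r y)) y)"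
      using comparable EA_Ob_image r_Ob EA_image_in_C
      by (auto simp: inclusion_functor_def reach_EA_iff image.reach_EA_iff r_image)
  qed (use thin_action_EA image.thin_action_EA r_action in \<open>auto simp: inclusion_functor_def\<close>)
qed

end

theorem lemma2p2:
  fixes G :: "('g, 'c) monoid_scheme"
    and C :: "'g set set"
    and F :: "'g set \<Rightarrow> 'g set"
  assumes "group G"
    and "collection G C"
    and "F \<in> C \<rightarrow> C"
    and "mono_on C F"
    and "\<forall>g\<in>carrier G. \<forall>P\<in>C. F (conjugate G g P) = conjugate G g (F P)"
    and "(\<forall>P\<in>C. P \<subseteq> F P) \<or> (\<forall>P\<in>C. F P \<subseteq> P)"
  shows "((\<forall>P\<in>C. P \<subseteq> F P) \<longrightarrow>
            induces_G_homotopy_equivalence G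
              (EO G (F ` C)) (EO_action G) (EO G C) (EO_action G) inclusion_functor) \<and>
         ((\<forall>P\<in>C. centralizer G P \<subseteq> centralizer G (F P)) \<longrightarrow>
            induces_G_homotopy_equivalence G
              (EA G (F ` C)) (EA_action G) (EA G C) (EA_action G) inclusion_functor) \<and>
         ((\<forall>P\<in>C. F P \<subseteq> P) \<longrightarrow> (\<forall>P\<in>C. centralizer G P \<subseteq> centralizer G (F P))) \<and>
         induces_G_homotopy_equivalence G
           (poset_cat (F ` C)) (poset_action G) (poset_cat C) (poset_action G) inclusion_functor"
proof -
  interpret group G by fact
  interpret collection_endomorphism G C F
    by unfold_locales (use assms in auto)
  show ?thesis
    using assms(6) EO_G_homotopy_equivalence EA_G_homotopy_equivalence
      poset_G_homotopy_equivalence centralizer_antimono by metis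
qed

end
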